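(* Let $\mathcal{U}$ and $\mathcal{V}_i$ ($i\in I$) be Hilbert modules over a pro-$C^*$-algebra $\mathcal{A}$, let $K\in Hom_{\mathcal{A}}^*(\mathcal{U})$, and let $\{\mathfrak{E}_i\in Hom_{\mathcal{A}}^*(\mathcal{U},\mathcal{V}_i)\}_{i\in I}$ be a $g$-orthonormal basis for $\mathcal{U}$ with respect to $\{\mathcal{V}_i\}_{i\in I}$. Let $\{\Gamma_i\}_{i\in I}$ be a $K$-$g$-frame for $\mathcal{U}$ with respect to $\{\mathcal{V}_i\}_{i\in I}$ with associated $g$-operator $Q$, and let $P$ be the $g$-operator of a $g$-frame sequence $\{T_i\}_{i\in I}$ for $\mathcal{U}$ with respect to $\{\mathcal{V}_i\}_{i\in I}$. Then $\{T_i\}_{i\in I}$ is a $K$-dual $g$-frame sequence of $\{\Gamma_i\}_{i\in I}$ if and only if $K=QP^*$.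
   Context: A pro-$C^*$-algebra (locally $C^*$-algebra) $\mathcal{A}$ is a complete Hausdorff complex topological $*$-algebra whose topology is determined by the set $Se(\mathcal{A})$ of its continuous $C^*$-seminorms $p$ (so $p(ab)\le p(a)p(b)$, $p(a^*a)=p(a)^2$). A Hilbert $\mathcal{A}$-module is a left $\mathcal{A}$-module $\mathcal{U}$ with an $\mathcal{A}$-valued inner product $\langle\cdot,\cdot\rangle$, $\mathbb{C}$- and $\mathcal{A}$-linear in the first argument, with $\langle\xi,\eta\rangle^*=\langle\eta,\xi\rangle$, $\langle\xi,\xi\rangle\ge0$, and $\langle\xi,\xi\rangle=0$ iff $\xi=0$, complete for the seminorms $\bar p_{\mathcal{U}}(\xi)=\sqrt{p(\langle\xi,\xi\rangle)}$, $p\in Se(\mathcal{A})$. $I$ is a countably infinite index set. $Hom_{\mathcal{A}}^*(\mathcal{U},\mathcal{V})$ is the set of adjointable $\mathcal{A}$-module maps $\mathcal{U}\to\mathcal{V}$, and $Hom_{\mathcal{A}}^*(\mathcal{U})=Hom_{\mathcal{A}}^*(\mathcal{U},\mathcal{U})$. A sequence $\{\Gamma_i\in Hom_{\mathcal{A}}^*(\mathcal{U},\mathcal{V}_i)\}_{i\in I}$ is a $g$-frame for $\mathcal{U}$ with respect to $\{\mathcal{V}_i\}$ if there are constants $A,B>0$ with $A\langle\xi,\xi\rangle\le\sum_{i\in I}\langle\Gamma_i\xi,\Gamma_i\xi\rangle\le B\langle\xi,\xi\rangle$ for all $\xi\in\mathcal{U}$. A $g$-frame sequence is a sequence that is a $g$-frame.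 For $K\in Hom_{\mathcal{A}}^*(\mathcal{U})$, the sequence is a $K$-$g$-frame for $\mathcal{U}$ with respect to $\{\mathcal{V}_i\}$ if there are constants $C,D>0$ with $C\langle K^*\xi,K^*\xi\rangle\le\sum_{i\in I}\langle\Gamma_i\xi,\Gamma_i\xi\rangle\le D\langle\xi,\xi\rangle$ for all $\xi\in\mathcal{U}$. A sequence $\{\mathfrak{E}_i\in Hom_{\mathcal{A}}^*(\mathcal{U},\mathcal{V}_i)\}_{i\in I}$ is a $g$-orthonormal basis for $\mathcal{U}$ with respect to $\{\mathcal{V}_i\}$ if $\langle\mathfrak{E}_i^*g_i,\mathfrak{E}_j^*g_j\rangle=\delta_{ij}\langle g_i,g_j\rangle$ for all $i,j\in I$, $g_i\in\mathcal{V}_i$, $g_j\in\mathcal{V}_j$, and $\sum_{i\in I}\bar p_{\mathcal{V}_i}(\mathfrak{E}_i\xi)^2=\bar p_{\mathcal{U}}(\xi)^2$ for all $\xi\in\mathcal{U}$, $p\in Se(\mathcal{A})$. Given a fixed $g$-orthonormal basis $\{\mathfrak{E}_i\}$, the $g$-operator corresponding to $\{\Gamma_i\}$ is the unique bounded operator $Q\in Hom_{\mathcal{A}}^*(\mathcal{U})$ with $\Gamma_i=\mathfrak{E}_iQ^*$ for all $i\in I$. A $g$-frame sequence $\{\Xi_i\}_{i\in I}$ for $\mathcal{U}$ with respect to $\{\mathcal{V}_i\}$ is a $K$-dual $g$-frame sequence of a $K$-$g$-frame $\{\Gamma_i\}_{i\in I}$ if $K\xi=\sum_{i\in I}\Gamma_i^*\Xi_i\xi$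 for all $\xi\in\mathcal{U}$. *)

theory Defs
  imports "HOL-Analysis.Analysis" "HOL-Algebra.Module"
begin

text \<open>Complex *-algebras. No unit is assumed.\<close>

class complex_star_algebra = ring +
  fixes scaleC :: "complex \<Rightarrow> 'a \<Rightarrow> 'a" (infixr \<open>*\<^sub>C\<close> 75)
    and star :: "'a \<Rightarrow> 'a"
  assumes scaleC_add_right: "c *\<^sub>C (a + b) = c *\<^sub>C a + c *\<^sub>C b"
    and scaleC_add_left: "(c + d) *\<^sub>C a = c *\<^sub>C a + d *\<^sub>C a"
    and scaleC_scaleC: "c *\<^sub>C d *\<^sub>C a = (c * d) *\<^sub>C a"
    and scaleC_one: "1 *\<^sub>C a = a"
    and mult_scaleC_left: "(c *\<^sub>C a) * b = c *\<^sub>C (a * b)"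
    and mult_scaleC_right: "a * (c *\<^sub>C b) = c *\<^sub>C (a * b)"
    and star_add: "star (a + b) = star a + star b"
    and star_scaleC: "star (c *\<^sub>C a) = cnj c *\<^sub>C star a"
    and star_mult: "star (a * b) = star b * star a"
    and star_star: "star (star a) = a"

definition positive :: "'a::complex_star_algebra \<Rightarrow> bool" where
  "positive a \<longleftrightarrow> (\<exists>b. a = star b * b)"

definition le_positive :: "'a::complex_star_algebra \<Rightarrow> 'a \<Rightarrow> bool" (infix \<open>\<preceq>\<close> 50) where
  "a \<preceq> b \<longleftrightarrow> positive (b - a)"

definition (in complex_star_algebra) cstar_seminorm :: "('a \<Rightarrow> real) \<Rightarrow> bool" where
  "cstar_seminorm p \<longleftrightarrow>
     (\<forall>a. 0 \<le> p a) \<and>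
     (\<forall>a b. p (a + b) \<le> p a + p b) \<and>
     (\<forall>c a. p (c *\<^sub>C a) = cmod c * p a) \<and>
     (\<forall>a b. p (a * b) \<le> p a * p b) \<and>
     (\<forall>a. p (star a * a) = (p a)\<^sup>2)"

class topological_star_algebra =
  complex_star_algebra + topological_ab_group_add + topological_semigroup_mult +
  assumes tendsto_scaleC_Pair:
      "LIM x (nhds c \<times>\<^sub>F nhds a). fst x *\<^sub>C snd x :> nhds (c *\<^sub>C a)"
    and tendsto_star_nhds: "LIM x (nhds a). star x :> nhds (star a)"

definition (in topological_star_algebra) Se :: "('a \<Rightarrow> real) set" where
  "Se = {p. cstar_seminorm p \<and> (\<forall>a. (p \<longlongrightarrow> p a) (nhds a))}"

text \<open>The uniformity (and hence the topology) is the one generated by the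
  continuous C*-seminorms; completeness is that of the library (Cauchy filters converge).\<close>

class pro_cstar_algebra = topological_star_algebra + uniform_space + t2_space +
  assumes uniformity_Se:
      "uniformity = (INF p\<in>Se. INF e\<in>{0<..}. principal {(x, y). p (x - y) < e})"
    and complete_UNIV_pro_cstar: "complete UNIV"

text \<open>The ring multiplication and unit fields that \<open>hilbert_mod\<close> inherits from the
  library's \<open>module\<close> record are unused. Modules are given on carriers so that the members
  of a family may have different underlying sets.\<close>

record ('a, 'm) hilbert_mod = "('a, 'm) module" +
  cscale :: "complex \<Rightarrow> 'm \<Rightarrow> 'm"
  iprod :: "'m \<Rightarrow> 'm \<Rightarrow> 'a"

definition pbar :: "('a, 'm) hilbert_mod \<Rightarrow> ('a \<Rightarrow> real) \<Rightarrow> 'm \<Rightarrow> real" where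
  "pbar M p x = sqrt (p (iprod M x x))"

locale hilbert_module = abelian_group M
  for M :: "('a::pro_cstar_algebra, 'm) hilbert_mod" (structure) +
  assumes smult_closed: "x \<in> carrier M \<Longrightarrow> a \<odot> x \<in> carrier M"
    and smult_add_left: "x \<in> carrier M \<Longrightarrow> (a + b) \<odot> x = a \<odot> x \<oplus> b \<odot> x"
    and smult_add_right:
      "\<lbrakk>x \<in> carrier M; y \<in> carrier M\<rbrakk> \<Longrightarrow> a \<odot> (x \<oplus> y) = a \<odot> x \<oplus> a \<odot> y"
    and smult_assoc: "x \<in> carrier M \<Longrightarrow> (a * b) \<odot> x = a \<odot> (b \<odot> x)"
    and cscale_closed: "x \<in> carrier M \<Longrightarrow> cscale M c x \<in> carrier M"
    and cscale_add_left:
      "x \<in> carrier M \<Longrightarrow> cscale M (c + d) x = cscale M c x \<oplus> cscale M d x"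
    and cscale_add_right:
      "\<lbrakk>x \<in> carrier M; y \<in> carrier M\<rbrakk> \<Longrightarrow>
         cscale M c (x \<oplus> y) = cscale M c x \<oplus> cscale M c y"
    and cscale_cscale: "x \<in> carrier M \<Longrightarrow> cscale M c (cscale M d x) = cscale M (c * d) x"
    and cscale_one: "x \<in> carrier M \<Longrightarrow> cscale M 1 x = x"
    and scaleC_smult: "x \<in> carrier M \<Longrightarrow> (c *\<^sub>C a) \<odot> x = cscale M c (a \<odot> x)"
    and smult_cscale: "x \<in> carrier M \<Longrightarrow> a \<odot> cscale M c x = cscale M c (a \<odot> x)"
    and iprod_add_left:
      "\<lbrakk>x \<in> carrier M; y \<in> carrier M; z \<in> carrier M\<rbrakk> \<Longrightarrow>
         iprod M (x \<oplus> y) z = iprod M x z + iprod M y z"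
    and iprod_cscale_left:
      "\<lbrakk>x \<in> carrier M; y \<in> carrier M\<rbrakk> \<Longrightarrow> iprod M (cscale M c x) y = c *\<^sub>C iprod M x y"
    and iprod_smult_left:
      "\<lbrakk>x \<in> carrier M; y \<in> carrier M\<rbrakk> \<Longrightarrow> iprod M (a \<odot> x) y = a * iprod M x y"
    and star_iprod: "\<lbrakk>x \<in> carrier M; y \<in> carrier M\<rbrakk> \<Longrightarrow> star (iprod M x y) = iprod M y x"
    and positive_iprod: "x \<in> carrier M \<Longrightarrow> positive (iprod M x x)"
    and iprod_eq_0_iff: "x \<in> carrier M \<Longrightarrow> iprod M x x = 0 \<longleftrightarrow> x = \<zero>"
    and complete_pbar:
      "\<lbrakk>F \<noteq> bot; F \<le> principal (carrier M);
        \<And>p e. \<lbrakk>p \<in> Se; 0 < e\<rbrakk> \<Longrightarrow>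
          eventually (\<lambda>(x, y). pbar M p (x \<ominus> y) < e) (F \<times>\<^sub>F F)\<rbrakk> \<Longrightarrow>
         \<exists>x\<in>carrier M. \<forall>p\<in>Se. ((\<lambda>y. pbar M p (y \<ominus> x)) \<longlongrightarrow> 0) F"

definition hom_star ::
  "('a::pro_cstar_algebra, 'u) hilbert_mod \<Rightarrow> ('a, 'v) hilbert_mod \<Rightarrow> ('u \<Rightarrow> 'v) set" where
  "hom_star U V = {T \<in> carrier U \<rightarrow> carrier V.
     (\<forall>x\<in>carrier U. \<forall>y\<in>carrier U. T (x \<oplus>\<^bsub>U\<^esub> y) = T x \<oplus>\<^bsub>V\<^esub> T y) \<and>
     (\<forall>c. \<forall>x\<in>carrier U. T (cscale U c x) = cscale V c (T x)) \<and>
     (\<forall>a. \<forall>x\<in>carrier U. T (a \<odot>\<^bsub>U\<^esub> x) = a \<odot>\<^bsub>V\<^esub> T x) \<and>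
     (\<exists>S\<in>carrier V \<rightarrow> carrier U.
        \<forall>x\<in>carrier U. \<forall>y\<in>carrier V. iprod V (T x) y = iprod U x (S y))}"

text \<open>The adjoint of \<open>T \<in> hom_star U V\<close>; only its values on \<open>carrier V\<close> are meaningful.\<close>

definition adj ::
  "('a::pro_cstar_algebra, 'u) hilbert_mod \<Rightarrow> ('a, 'v) hilbert_mod \<Rightarrow> ('u \<Rightarrow> 'v) \<Rightarrow> 'v \<Rightarrow> 'u" where
  "adj U V T y = (THE z. z \<in> carrier U \<and> (\<forall>x\<in>carrier U. iprod V (T x) y = iprod U x z))"

definition bounded_op ::
  "('a::pro_cstar_algebra, 'u) hilbert_mod \<Rightarrow> ('a, 'v) hilbert_mod \<Rightarrow> ('u \<Rightarrow> 'v) \<Rightarrow> bool" where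
  "bounded_op U V T \<longleftrightarrow> (\<forall>p\<in>Se. \<exists>C. \<forall>x\<in>carrier U. pbar V p (T x) \<le> C * pbar U p x)"

definition has_sum_in ::
  "('a::pro_cstar_algebra, 'm) hilbert_mod \<Rightarrow> ('i \<Rightarrow> 'm) \<Rightarrow> 'm \<Rightarrow> 'i set \<Rightarrow> bool" where
  "has_sum_in M f s I \<longleftrightarrow>
     (\<forall>p\<in>Se. ((\<lambda>F. pbar M p ((\<Oplus>\<^bsub>M\<^esub>i\<in>F. f i) \<ominus>\<^bsub>M\<^esub> s)) \<longlongrightarrow> 0) (finite_subsets_at_top I))"

definition g_frame ::
  "'i set \<Rightarrow> ('a::pro_cstar_algebra, 'u) hilbert_mod \<Rightarrow> ('i \<Rightarrow> ('a, 'v) hilbert_mod) \<Rightarrow>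
   ('i \<Rightarrow> 'u \<Rightarrow> 'v) \<Rightarrow> bool" where
  "g_frame I U V \<Gamma> \<longleftrightarrow>
     (\<forall>i\<in>I. \<Gamma> i \<in> hom_star U (V i)) \<and>
     (\<exists>A>0. \<exists>B>0. \<forall>x\<in>carrier U. \<exists>s.
        ((\<lambda>i. iprod (V i) (\<Gamma> i x) (\<Gamma> i x)) has_sum s) I \<and>
        complex_of_real A *\<^sub>C iprod U x x \<preceq> s \<and>
        s \<preceq> complex_of_real B *\<^sub>C iprod U x x)"

definition K_g_frame ::
  "'i set \<Rightarrow> ('a::pro_cstar_algebra, 'u) hilbert_mod \<Rightarrow> ('i \<Rightarrow> ('a, 'v) hilbert_mod) \<Rightarrow>
   ('u \<Rightarrow> 'u) \<Rightarrow> ('i \<Rightarrow> 'u \<Rightarrow> 'v) \<Rightarrow> bool" where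
  "K_g_frame I U V K \<Gamma> \<longleftrightarrow>
     (\<forall>i\<in>I. \<Gamma> i \<in> hom_star U (V i)) \<and>
     (\<exists>C>0. \<exists>D>0. \<forall>x\<in>carrier U. \<exists>s.
        ((\<lambda>i. iprod (V i) (\<Gamma> i x) (\<Gamma> i x)) has_sum s) I \<and>
        complex_of_real C *\<^sub>C iprod U (adj U U K x) (adj U U K x) \<preceq> s \<and>
        s \<preceq> complex_of_real D *\<^sub>C iprod U x x)"

definition g_orthonormal_basis ::
  "'i set \<Rightarrow> ('a::pro_cstar_algebra, 'u) hilbert_mod \<Rightarrow> ('i \<Rightarrow> ('a, 'v) hilbert_mod) \<Rightarrow>
   ('i \<Rightarrow> 'u \<Rightarrow> 'v) \<Rightarrow> bool" where
  "g_orthonormal_basis I U V E \<longleftrightarrow>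
     (\<forall>i\<in>I. E i \<in> hom_star U (V i)) \<and>
     (\<forall>i\<in>I. \<forall>j\<in>I. \<forall>g\<in>carrier (V i). \<forall>h\<in>carrier (V j).
        iprod U (adj U (V i) (E i) g) (adj U (V j) (E j) h) =
          (if i = j then iprod (V i) g h else 0)) \<and>
     (\<forall>x\<in>carrier U. \<forall>p\<in>Se.
        ((\<lambda>i. (pbar (V i) p (E i x))\<^sup>2) has_sum (pbar U p x)\<^sup>2) I)"

text \<open>For a g-orthonormal basis \<open>E\<close> such a \<open>Q\<close> is unique on \<open>carrier U\<close>: by Parseval,
  the values \<open>E i (adj U U Q x)\<close> for \<open>i \<in> I\<close> determine \<open>adj U U Q x\<close>.\<close>

definition is_g_operator ::
  "'i set \<Rightarrow> ('a::pro_cstar_algebra, 'u) hilbert_mod \<Rightarrow> ('i \<Rightarrow> ('a, 'v) hilbert_mod) \<Rightarrow>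
   ('i \<Rightarrow> 'u \<Rightarrow> 'v) \<Rightarrow> ('i \<Rightarrow> 'u \<Rightarrow> 'v) \<Rightarrow> ('u \<Rightarrow> 'u) \<Rightarrow> bool" where
  "is_g_operator I U V E \<Gamma> Q \<longleftrightarrow>
     Q \<in> hom_star U U \<and> bounded_op U U Q \<and>
     (\<forall>i\<in>I. \<forall>x\<in>carrier U. \<Gamma> i x = E i (adj U U Q x))"

definition K_dual_g_frame ::
  "'i set \<Rightarrow> ('a::pro_cstar_algebra, 'u) hilbert_mod \<Rightarrow> ('i \<Rightarrow> ('a, 'v) hilbert_mod) \<Rightarrow>
   ('u \<Rightarrow> 'u) \<Rightarrow> ('i \<Rightarrow> 'u \<Rightarrow> 'v) \<Rightarrow> ('i \<Rightarrow> 'u \<Rightarrow> 'v) \<Rightarrow> bool" where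
  "K_dual_g_frame I U V K \<Gamma> \<Xi> \<longleftrightarrow>
     K_g_frame I U V K \<Gamma> \<and> g_frame I U V \<Xi> \<and>
     (\<forall>x\<in>carrier U. has_sum_in U (\<lambda>i. adj U (V i) (\<Gamma> i) (\<Xi> i x)) (K x) I)"

end

theory Submission
  imports Defs
begin

text \<open>Since \<open>\<Gamma>\<^sub>i = E\<^sub>i Q\<^sup>*\<close> and \<open>T\<^sub>i = E\<^sub>i P\<^sup>*\<close>, one has \<open>\<Gamma>\<^sub>i\<^sup>* T\<^sub>i x = Q E\<^sub>i\<^sup>* E\<^sub>i P\<^sup>* x\<close>. By Parseval's
  identity \<open>\<Sum>\<^sub>i E\<^sub>i\<^sup>* E\<^sub>i y = y\<close>, and \<open>Q\<close> is bounded, so \<open>\<Sum>\<^sub>i \<Gamma>\<^sub>i\<^sup>* T\<^sub>i x = Q P\<^sup>* x\<close>. The claim then is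
  the uniqueness of limits in \<open>U\<close>. By the parallelogram law, this follows from
  \<open>p (b\<^sup>* b) \<le> p (b\<^sup>* b + c\<^sup>* c)\<close> for C*-seminorms \<open>p\<close>, that is, from the positivity of \<open>c\<^sup>* c\<close>. The
  algebra need not be complete for \<open>p\<close> alone, so positivity is expressed by norm estimates for
  polynomials instead of by spectra.\<close>

subsection \<open>Positivity in C*-seminormed algebras\<close>

lemma scaleC_0_left [simp]: "0 *\<^sub>C (a::'a::complex_star_algebra) = 0"
  using scaleC_add_left[of 0 0 a] by simp

lemma scaleC_0_right [simp]: "c *\<^sub>C (0::'a::complex_star_algebra) = 0"
  using scaleC_add_right[of c 0 "0::'a"] by simp

lemma scaleC_minus_left: "(- c) *\<^sub>C (a::'a::complex_star_algebra) = - (c *\<^sub>C a)"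
  using scaleC_add_left[of "- c" c a] by (simp add: eq_neg_iff_add_eq_0)

lemma scaleC_minus1: "(- 1) *\<^sub>C (a::'a::complex_star_algebra) = - a"
  by (simp add: scaleC_minus_left scaleC_one)

lemma scaleC_minus_right: "c *\<^sub>C (- a) = - (c *\<^sub>C (a::'a::complex_star_algebra))"
  using scaleC_add_right[of c "- a" a] by (simp add: eq_neg_iff_add_eq_0)

lemma scaleC_diff_right: "c *\<^sub>C (a - b) = c *\<^sub>C a - c *\<^sub>C (b::'a::complex_star_algebra)"
  using scaleC_add_right[of c a "- b"] by (simp add: scaleC_minus_right)

lemma star_0 [simp]: "star (0::'a::complex_star_algebra) = 0"
  using star_add[of 0 "0::'a"] by simp

lemma star_minus: "star (- a) = - star (a::'a::complex_star_algebra)"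
  using star_add[of "- a" a] by (simp add: eq_neg_iff_add_eq_0)

lemma star_diff: "star (a - b) = star a - star (b::'a::complex_star_algebra)"
  using star_add[of a "- b"] by (simp add: star_minus)

locale cstar_seminormed =
  fixes p :: "'a::complex_star_algebra \<Rightarrow> real"
  assumes cstar: "cstar_seminorm p"
begin

lemma nonneg [simp]: "0 \<le> p a"
  and triangle: "p (a + b) \<le> p a + p b"
  and scale: "p (c *\<^sub>C a) = cmod c * p a"
  and submult: "p (a * b) \<le> p a * p b"
  and cstar_id: "p (star a * a) = (p a)\<^sup>2"
  using cstar by (auto simp: cstar_seminorm_def)

lemma zero [simp]: "p 0 = 0"
  using scale[of 0 0] by simp

lemma minus [simp]: "p (- a) = p a"
  using scale[of "- 1" a] by (simp add: scaleC_minus1)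

lemma triangle_diff: "p (a - b) \<le> p a + p b"
  using triangle[of a "- b"] by simp

text \<open>The C*-identity gives \<open>p a * p a \<le> p (star a) * p a\<close>, and a nonzero
  \<open>p a\<close> cancels.\<close>

lemma star_le: "p a \<le> p (star a)"
proof (cases "p a = 0")
  case False
  have "p a * p a \<le> p (star a) * p a"
    using submult[of "star a" a] by (simp add: cstar_id power2_eq_square)
  then show ?thesis
    using False nonneg[of a] by (simp add: mult_le_cancel_right)
qed simp

lemma star_eq [simp]: "p (star a) = p a"
  using star_le[of a] star_le[of "star a"] by (simp add: star_star)

lemma square_self_adjoint: "star h = h \<Longrightarrow> p (h * h) = (p h)\<^sup>2"
  using cstar_id[of h] by simp

text \<open>With \<open>z = h + i k\<close> one has \<open>z\<^sup>* z = h\<^sup>2 + k\<^sup>2\<close>, and \<open>h\<close> is the real part of \<open>z\<close>.\<close>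

lemma square_le_sum_squares:
  assumes "star h = h" "star k = k" "h * k = k * h"
  shows "(p h)\<^sup>2 \<le> p (h * h + k * k)"
proof -
  define z where "z = h + \<i> *\<^sub>C k"
  have sz: "star z = h - \<i> *\<^sub>C k"
    using assms by (simp add: z_def star_add star_scaleC scaleC_minus_left)
  have "star z * z = h * h + k * k"
    unfolding sz by (simp add: z_def algebra_simps mult_scaleC_left mult_scaleC_right
        scaleC_scaleC scaleC_minus1 scaleC_diff_right scaleC_add_right assms(3))
  then have *: "p (h * h + k * k) = (p z)\<^sup>2"
    using cstar_id[of z] by simp
  have "h = (1/2) *\<^sub>C (z + star z)"
    unfolding sz by (simp add: z_def flip: scaleC_add_right)
      (simp add: scaleC_add_right flip: scaleC_add_left, simp add: scaleC_one)
  then have "p h = 1/2 * p (z + star z)"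
    using scale[of "1/2" "z + star z"] by simp
  then have "p h \<le> p z"
    using triangle[of z "star z"] by simp
  then show ?thesis
    unfolding * by (simp add: power_mono)
qed

end

text \<open>Exponential growth beats a linear factor. This takes the role of the spectral radius
  formula; the exponents are powers of two because \<open>p_power_two_power\<close> computes the
  seminorms of these powers.\<close>

lemma le_if_powers_le:
  fixes a b D :: real
  assumes "0 < b" and le: "\<And>k. a ^ (2 ^ k) \<le> b ^ (2 ^ k) * (1 + real (2 ^ k) * D)"
  shows "a \<le> b"
proof (rule ccontr)
  assume "\<not> a \<le> b"
  define q where "q = b / a"
  have a: "0 < a" "0 < q" "q < 1"
    using \<open>\<not> a \<le> b\<close> \<open>0 < b\<close> by (auto simp: q_def)
  have "(\<lambda>n. q ^ n + D * (real n * q ^ n)) \<longlonglongrightarrow> 0 + D * 0"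
    using a by (intro tendsto_intros LIMSEQ_power_zero powser_times_n_limit_0) auto
  then have "eventually (\<lambda>n. q ^ n + D * (real n * q ^ n) < 1) sequentially"
    by (intro order_tendstoD) auto
  then obtain n0 where n0: "\<And>n. n \<ge> n0 \<Longrightarrow> q ^ n + D * (real n * q ^ n) < 1"
    by (auto simp: eventually_sequentially)
  define n :: nat where "n = 2 ^ n0"
  have "n \<ge> n0"
    by (simp add: n_def less_imp_le)
  have "a ^ n \<le> b ^ n * (1 + real n * D)"
    using le[of n0] by (simp add: n_def)
  also have "\<dots> = a ^ n * (q ^ n + D * (real n * q ^ n))"
    using a by (simp add: q_def power_divide field_simps)
  also have "\<dots> < a ^ n * 1"
    using n0[OF \<open>n \<ge> n0\<close>] a by (intro mult_strict_left_mono) auto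
  finally show False by simp
qed

section \<open>Positive elements of a unital algebra\<close>

locale unital_cstar_seminormed = cstar_seminormed p
  for p :: "'a::{complex_star_algebra, ring_1} \<Rightarrow> real"
begin

definition sc :: "real \<Rightarrow> 'a" where
  "sc t = complex_of_real t *\<^sub>C 1"

lemma star_1: "star (1::'a) = 1"
  using star_mult[of "star (1::'a)" 1] by (simp add: star_star)

lemma sc_add: "sc (s + t) = sc s + sc t"
  by (simp add: sc_def scaleC_add_left)

lemma sc_minus: "sc (- t) = - sc t"
  by (simp add: sc_def scaleC_minus_left)

lemma sc_diff: "sc (s - t) = sc s - sc t"
  using sc_add[of s "- t"] by (simp add: sc_minus)

lemma sc_mult: "sc (s * t) = sc s * sc t"
  by (simp add: sc_def mult_scaleC_left scaleC_scaleC)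

lemma sc_0 [simp]: "sc 0 = 0" and sc_1 [simp]: "sc 1 = 1"
  by (simp_all add: sc_def scaleC_one)

lemma sc_2: "sc 2 = 2"
  using sc_add[of 1 1] by simp

lemmas sc_algebra = sc_def star_1 star_scaleC mult_scaleC_left mult_scaleC_right
  scaleC_scaleC scaleC_add_right scaleC_diff_right scaleC_minus_right

lemma star_sc [simp]: "star (sc t) = sc t"
  by (simp add: sc_def star_scaleC star_1)

lemma p_sc_mult: "p (sc t * a) = \<bar>t\<bar> * p a"
  by (simp add: sc_def mult_scaleC_left scale)

text \<open>Since \<open>p 1\<close> equals its own square, it is 0 or 1; it is 0 when
  \<open>p\<close> vanishes identically.\<close>

lemma p_1: "p 1 \<le> 1"
proof -
  have "p 1 * p 1 = 1 * p 1"
    using cstar_id[of 1] by (simp add: star_1 power2_eq_square)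
  then show ?thesis
    by (cases "p 1 = 0") auto
qed

lemma p_sc: "p (sc t) \<le> \<bar>t\<bar>"
  using p_sc_mult[of t 1] p_1 by (simp add: mult_left_le)

text \<open>Squares of self-adjoint elements are self-adjoint, so the identity for squares can be
  iterated.\<close>

lemma p_power_two_power: "star h = h \<Longrightarrow> p (h ^ (2 ^ k)) = p h ^ (2 ^ k)"
proof (induction k arbitrary: h)
  case (Suc k)
  have "p ((h * h) ^ (2 ^ k)) = p (h * h) ^ (2 ^ k)"
    using Suc by (intro Suc.IH) (simp add: star_mult)
  then show ?case
    using Suc.prems by (simp add: square_self_adjoint power_mult power2_eq_square)
qed simp

text \<open>Since \<open>p (M - a) - M\<close> decreases in \<open>M\<close>, this says that the limit of that
  difference for \<open>M \<rightarrow> \<infinity>\<close>, which is the maximum of the spectrum of \<open>- a\<close>, is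
  nonpositive.\<close>

definition psd :: "'a \<Rightarrow> bool" where
  "psd a \<longleftrightarrow> star a = a \<and> (\<forall>e>0. \<exists>M\<ge>0. p (sc M - a) \<le> M + e)"

lemma psd_self_adjoint: "psd a \<Longrightarrow> star a = a"
  by (simp add: psd_def)

text \<open>Raising \<open>M\<close> by some amount raises \<open>p (sc M - a)\<close> by at most
  that amount, so an admissible \<open>M\<close> can be replaced by any larger one.\<close>

lemma psd_large:
  assumes "psd a" "0 < e"
  obtains M where "M \<ge> L" "M \<ge> 0" "p (sc M - a) \<le> M + e"
proof -
  obtain M where M: "M \<ge> 0" "p (sc M - a) \<le> M + e"
    using assms by (auto simp: psd_def)
  define M' where "M' = max L M"
  have "p (sc M' - a) \<le> p (sc (M' - M)) + p (sc M - a)"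
    using triangle[of "sc (M' - M)" "sc M - a"] by (simp add: sc_diff)
  also have "\<dots> \<le> (M' - M) + (M + e)"
    using p_sc[of "M' - M"] M by (intro add_mono) (auto simp: M'_def)
  finally show ?thesis
    using M by (intro that[of M']) (auto simp: M'_def)
qed

lemma psd_add:
  assumes "psd a" "psd b"
  shows "psd (a + b)"
  unfolding psd_def
proof (intro conjI allI impI)
  show "star (a + b) = a + b"
    using assms by (simp add: star_add psd_self_adjoint)
  fix e :: real
  assume "0 < e"
  then obtain M M' where M: "M \<ge> 0" "p (sc M - a) \<le> M + e/2"
      "M' \<ge> 0" "p (sc M' - b) \<le> M' + e/2"
    using assms by (meson half_gt_zero psd_def)
  have "p (sc (M + M') - (a + b)) \<le> p (sc M - a) + p (sc M' - b)"
    using triangle[of "sc M - a" "sc M' - b"] by (simp add: sc_add algebra_simps)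
  then show "\<exists>M\<ge>0. p (sc M - (a + b)) \<le> M + e"
    using M by (intro exI[of _ "M + M'"]) auto
qed

lemma psd_closed:
  assumes sa: "star a = a" and approx: "\<And>e. 0 < e \<Longrightarrow> \<exists>b. psd b \<and> p (b - a) \<le> e"
  shows "psd a"
  unfolding psd_def
proof (intro conjI allI impI sa)
  fix e :: real
  assume "0 < e"
  then obtain b where b: "psd b" "p (b - a) \<le> e/2"
    using approx[of "e/2"] by auto
  obtain M where M: "M \<ge> 0" "p (sc M - b) \<le> M + e/2"
    using b \<open>0 < e\<close> by (meson half_gt_zero psd_def)
  have "p (sc M - a) \<le> p (sc M - b) + p (b - a)"
    using triangle[of "sc M - b" "b - a"] by simp
  then show "\<exists>M\<ge>0. p (sc M - a) \<le> M + e"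
    using M b by (intro exI[of _ M]) auto
qed

text \<open>Adding \<open>2 M h\<^sup>2\<close>, the square of \<open>sqrt (2 M) h\<close>, to
  \<open>(M - h\<^sup>2)\<^sup>2\<close> cancels the mixed term and leaves
  \<open>M\<^sup>2 + h\<^sup>4\<close>. Hence \<open>p (M - h\<^sup>2)\<^sup>2\<close> is at most
  \<open>M\<^sup>2 + (p h)\<^sup>4\<close>, which is below \<open>(M + e)\<^sup>2\<close> once
  \<open>M e\<close> exceeds \<open>(p h)\<^sup>4\<close>.\<close>

lemma psd_square:
  assumes sa: "star h = h"
  shows "psd (h * h)"
  unfolding psd_def
proof (intro conjI allI impI)
  show "star (h * h) = h * h"
    using sa by (simp add: star_mult)
  fix e :: real
  assume "0 < e"
  define m where "m = p h"
  define M where "M = max 1 (m ^ 4 / e)"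
  have M: "M > 0" "m ^ 4 \<le> M * e"
    using \<open>0 < e\<close> by (auto simp: M_def field_simps max_def)
  define r where "r = sqrt (2 * M)"
  have rr: "sc r * sc r = sc M + sc M"
    using M by (simp add: r_def flip: sc_mult sc_add)
  have "(p (sc M - h * h))\<^sup>2
      \<le> p ((sc M - h * h) * (sc M - h * h) + (sc r * h) * (sc r * h))"
    using sa by (intro square_le_sum_squares)
      (auto simp: star_diff star_mult sc_algebra algebra_simps)
  also have "(sc r * h) * (sc r * h) = (sc M + sc M) * (h * h)"
    unfolding rr[symmetric] by (simp add: mult.assoc sc_algebra)
  also have "(sc M - h * h) * (sc M - h * h) + (sc M + sc M) * (h * h)
      = sc (M * M) + (h * h) * (h * h)"
    by (simp add: sc_algebra algebra_simps)
  also have "p \<dots> \<le> M * M + m ^ 4"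
  proof -
    have "p ((h * h) * (h * h)) \<le> m ^ 4"
      using submult[of "h * h" "h * h"] square_self_adjoint[OF sa]
      by (simp add: m_def power2_eq_square power4_eq_xxxx mult.assoc)
    moreover have "p (sc (M * M)) \<le> M * M"
      using p_sc[of "M * M"] by simp
    ultimately show ?thesis
      using triangle[of "sc (M * M)" "(h * h) * (h * h)"] by linarith
  qed
  also have "\<dots> \<le> (M + e)\<^sup>2"
    using M mult_pos_pos[OF \<open>0 < e\<close> \<open>0 < e\<close>] mult_pos_pos[OF M(1) \<open>0 < e\<close>]
    by (simp add: power2_eq_square algebra_simps)
  finally have "p (sc M - h * h) \<le> M + e"
    by (rule power2_le_imp_le) (use M \<open>0 < e\<close> in auto)
  then show "\<exists>M\<ge>0. p (sc M - h * h) \<le> M + e"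
    using M by (intro exI[of _ M]) auto
qed

lemma psd_bound:
  assumes "star y = y" "p y \<le> m"
  shows "psd (sc m - y)"
  unfolding psd_def
proof (intro conjI allI impI exI)
  show "star (sc m - y) = sc m - y"
    using assms by (simp add: star_diff)
  show "0 \<le> m"
    using assms(2) nonneg[of y] by linarith
  fix e :: real
  assume "0 < e"
  then show "p (sc m - (sc m - y)) \<le> m + e"
    using assms by simp
qed

section \<open>Approximate square roots and products of commuting positive elements\<close>

text \<open>The iteration \<open>w \<mapsto> (x + w\<^sup>2) / 2\<close> converges to \<open>1 - sqrt (1 - x)\<close>; the algebra
  need not be complete, so only approximate square roots are available.\<close>

lemma approx_sqrt_one_minus:
  assumes sa: "star x = x" and x1: "p x < 1" and "0 < e"
  obtains r where "star r = r" "\<And>b. x * b = b * x \<Longrightarrow> r * b = b * r"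
    "p (r * r - (1 - x)) \<le> e"
proof -
  define w where "w n = ((\<lambda>w. sc (1/2) * (x + w * w)) ^^ n) 0" for n
  have w0: "w 0 = 0" and wS: "w (Suc n) = sc (1/2) * (x + w n * w n)" for n
    by (simp_all add: w_def)
  \<comment> \<open>The iterates are polynomials in \<open>x\<close>, so they commute with whatever
    commutes with \<open>x\<close>, in particular with each other.\<close>
  have comm: "w n * b = b * w n" if "x * b = b * x" for n b
  proof (induction n)
    case (Suc n)
    have "w n * w n * b = b * (w n * w n)"
      by (metis Suc mult.assoc)
    then show ?case
      using that by (simp add: wS algebra_simps mult.assoc sc_algebra)
  qed (simp add: w0)
  have wsa: "star (w n) = w n" for n
    by (induction n) (simp_all add: w0 wS sa star_mult star_add sc_algebra)
  have ww: "w m * w n = w n * w m" for m n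
    using comm[of "w n" m] comm[of x n] by simp
  define \<rho> where "\<rho> = p x"
  have \<rho>: "0 \<le> \<rho>" "\<rho> < 1"
    using x1 by (auto simp: \<rho>_def)
  have wn: "p (w n) \<le> \<rho>" for n
  proof (induction n)
    case (Suc n)
    have "p (w n * w n) \<le> \<rho> * \<rho>"
      using submult[of "w n" "w n"] mult_mono[OF Suc Suc] \<rho> by auto
    moreover have "\<rho> * \<rho> \<le> \<rho>"
      using \<rho> by (simp add: mult_left_le)
    ultimately show ?case
      using triangle[of x "w n * w n"] by (simp add: wS p_sc_mult \<rho>_def)
  qed (simp add: w0 \<rho>)
  \<comment> \<open>The difference of consecutive iterates is half a difference of squares; its
    factor \<open>w (Suc n) + w n\<close>, halved, has seminorm at most
    \<open>\<rho>\<close>.\<close>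
  have diff: "p (w (Suc n) - w n) \<le> \<rho> ^ n" for n
  proof (induction n)
    case 0
    then show ?case
      using \<rho> wn[of 1] by (simp add: w0)
  next
    case (Suc n)
    have "w (Suc (Suc n)) - w (Suc n) = sc (1/2) * ((w (Suc n) - w n) * (w (Suc n) + w n))"
      unfolding wS[of "Suc n"] wS[of n, THEN arg_cong, of "\<lambda>u. _ - u"]
      using ww[of "Suc n" n] by (simp add: algebra_simps)
    then have "p (w (Suc (Suc n)) - w (Suc n))
        \<le> 1/2 * (p (w (Suc n) - w n) * p (w (Suc n) + w n))"
      using submult by (simp add: p_sc_mult)
    also have "\<dots> \<le> 1/2 * (\<rho> ^ n * (\<rho> + \<rho>))"
      using Suc wn[of n] wn[of "Suc n"] triangle[of "w (Suc n)" "w n"] \<rho>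
      by (intro mult_left_mono mult_mono) auto
    finally show ?case by (simp add: mult.commute)
  qed
  have "(\<lambda>n. 2 * \<rho> ^ n) \<longlonglongrightarrow> 2 * 0"
    using \<rho> by (intro tendsto_intros LIMSEQ_power_zero) auto
  then have "eventually (\<lambda>n. 2 * \<rho> ^ n < e) sequentially"
    using \<open>0 < e\<close> by (intro order_tendstoD) auto
  then obtain n where n: "2 * \<rho> ^ n < e"
    by (auto simp: eventually_sequentially)
  have dbl: "sc 2 * w (Suc n) = x + w n * w n"
    unfolding wS by (simp flip: mult.assoc sc_mult)
  \<comment> \<open>The defect of \<open>1 - w n\<close> as a square root of \<open>1 - x\<close> is
    twice the next increment of the iteration.\<close>
  have "(1 - w n) * (1 - w n) - (1 - x) = sc 2 * (w (Suc n) - w n)"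
    unfolding right_diff_distrib[of "sc 2"] dbl by (simp add: sc_2 algebra_simps mult_2)
  then have "p ((1 - w n) * (1 - w n) - (1 - x)) \<le> 2 * \<rho> ^ n"
    using diff[of n] by (simp add: p_sc_mult)
  then show ?thesis
  proof (intro that[of "1 - w n"])
    show "star (1 - w n) = 1 - w n"
      by (simp add: star_diff star_1 wsa)
    show "(1 - w n) * b = b * (1 - w n)" if "x * b = b * x" for b
      using comm[OF that] by (simp add: algebra_simps)
  qed (use n in linarith)
qed

text \<open>Rescaling reduces this to \<open>1 - x\<close>: with \<open>L = M + e/2\<close> and
  \<open>x = (M - a) / L\<close> one has \<open>L (1 - x) = a + e/2\<close>. As
  \<open>p (M - a)\<close> is at most \<open>M + e/4\<close>, the choice of \<open>L\<close> makes
  \<open>p x < 1\<close>; the shift by \<open>e/2\<close> uses up half of the allowed error.\<close>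

lemma approx_sqrt:
  assumes "psd a" "0 < e"
  obtains r where "star r = r" "\<And>b. a * b = b * a \<Longrightarrow> r * b = b * r"
    "p (r * r - a) \<le> e"
proof -
  obtain M where M: "M \<ge> 0" "p (sc M - a) \<le> M + e/4"
    using assms by (meson psd_large zero_less_divide_iff zero_less_numeral)
  define L where "L = M + e/2"
  have L: "L > 0"
    using M \<open>0 < e\<close> by (simp add: L_def)
  define x where "x = sc (1/L) * (sc M - a)"
  have xL: "sc L * x = sc M - a"
    using L by (simp add: x_def flip: mult.assoc sc_mult)
  have sa: "star x = x"
    using psd_self_adjoint[OF assms(1)] by (simp add: x_def star_mult star_diff sc_algebra)
  have "p x = p (sc M - a) / L"
    using L by (simp add: x_def p_sc_mult)
  also have "\<dots> < 1"
    using M L \<open>0 < e\<close> by (simp add: L_def)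
  finally have "p x < 1" .
  have "0 < e / (2 * L)"
    using L \<open>0 < e\<close> by simp
  obtain r where r: "star r = r" "\<And>b. x * b = b * x \<Longrightarrow> r * b = b * r"
      "p (r * r - (1 - x)) \<le> e / (2 * L)"
    using approx_sqrt_one_minus[OF sa \<open>p x < 1\<close> \<open>0 < e / (2 * L)\<close>] by blast
  define s where "s = sc (sqrt L) * r"
  have ss: "s * s = sc L * (r * r)"
  proof -
    have "s * s = sc (sqrt L) * sc (sqrt L) * (r * r)"
      by (simp add: s_def mult.assoc sc_algebra)
    then show ?thesis
      using L by (simp flip: sc_mult)
  qed
  have eq: "s * s - a = sc L * (r * r - (1 - x)) + sc (e/2)"
    by (simp add: ss right_diff_distrib xL) (simp add: L_def sc_add)
  have "p (s * s - a) \<le> L * (e / (2 * L)) + e/2"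
    unfolding eq using triangle[of "sc L * (r * r - (1 - x))" "sc (e/2)"] p_sc[of "e/2"]
      mult_left_mono[OF r(3), of L] L \<open>0 < e\<close> by (simp add: p_sc_mult)
  moreover have "s * b = b * s" if "a * b = b * a" for b
  proof -
    have "x * b = b * x"
      using that by (simp add: x_def algebra_simps sc_algebra)
    then show ?thesis
      using r(2)[of b] by (simp add: s_def mult.assoc sc_algebra)
  qed
  ultimately show ?thesis
    using L r(1) by (intro that[of s]) (auto simp: s_def star_mult sc_algebra)
qed

text \<open>Approximate square roots \<open>r\<close> of \<open>a\<close> and \<open>s\<close> of
  \<open>b\<close> commute as well, so \<open>a * b\<close> is close to the square of the
  self-adjoint element \<open>r * s\<close>.\<close>

lemma psd_mult:
  assumes "psd a" "psd b" "a * b = b * a"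
  shows "psd (a * b)"
proof (rule psd_closed)
  show "star (a * b) = a * b"
    using assms by (simp add: star_mult psd_self_adjoint)
  fix e :: real
  assume "0 < e"
  define S where "S = p a + p b + 1"
  have "0 < S"
    using nonneg[of a] nonneg[of b] by (simp add: S_def add_nonneg_pos)
  \<comment> \<open>The bound 1 gives \<open>p (s * s) \<le> p b + 1\<close>; the total error is
    then at most \<open>\<eta> * S\<close>.\<close>
  define \<eta> where "\<eta> = min 1 (e / S)"
  have \<eta>: "0 < \<eta>" "\<eta> \<le> 1" "\<eta> * S \<le> e"
    using \<open>0 < e\<close> \<open>0 < S\<close> by (auto simp: \<eta>_def min_def field_simps)
  obtain r where r: "star r = r" "\<And>c. a * c = c * a \<Longrightarrow> r * c = c * r" "p (r * r - a) \<le> \<eta>"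
    using approx_sqrt[OF assms(1) \<eta>(1)] by blast
  obtain s where s: "star s = s" "\<And>c. b * c = c * b \<Longrightarrow> s * c = c * s" "p (s * s - b) \<le> \<eta>"
    using approx_sqrt[OF assms(2) \<eta>(1)] by blast
  have rs: "r * s = s * r"
    using r(2)[of b] s(2)[of r] assms(3) by simp
  have sq: "(r * s) * (r * s) = (r * r) * (s * s)"
    by (metis mult.assoc rs)
  have eq: "(r * s) * (r * s) - a * b = (r * r - a) * (s * s) + a * (s * s - b)"
    unfolding sq by (simp add: algebra_simps)
  have "p ((r * s) * (r * s) - a * b) \<le> p (r * r - a) * p (s * s) + p a * p (s * s - b)"
    unfolding eq using triangle[of "(r * r - a) * (s * s)" "a * (s * s - b)"] submult[of "r * r - a" "s * s"]
      submult[of a "s * s - b"] by linarith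
  also have "p (s * s) \<le> p b + 1"
    using triangle[of "s * s - b" b] s(3) \<eta> by simp
  also have "p (r * r - a) * (p b + 1) + p a * p (s * s - b) \<le> \<eta> * (p b + 1) + p a * \<eta>"
    using r(3) s(3) \<eta>(1) by (intro add_mono mult_mono) auto
  also have "\<dots> \<le> e"
    using \<eta>(3) by (simp add: S_def algebra_simps)
  finally have "p ((r * s) * (r * s) - a * b) \<le> e"
    by (simp add: mult_left_mono)
  moreover have "psd ((r * s) * (r * s))"
    using r(1) s(1) rs by (intro psd_square) (simp add: star_mult)
  ultimately show "\<exists>c. psd c \<and> p (c - a * b) \<le> e"
    by blast
qed

lemma psd_1: "psd 1"
  using psd_square[of 1] by (simp add: star_1)

lemma psd_power: "psd a \<Longrightarrow> psd (a ^ n)"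
  by (induction n) (auto intro!: psd_mult psd_1 simp: power_commutes)

lemma psd_sum: "(\<And>i. i \<in> F \<Longrightarrow> psd (f i)) \<Longrightarrow> psd (sum f F)"
  using psd_bound[of 0 0] by (induction F rule: infinite_finite_induct) (auto intro: psd_add)

text \<open>The product \<open>m\<^sup>2 - y\<^sup>2\<close> of the two elements is approximately a square.\<close>

lemma bound_if_psd:
  assumes "psd (sc m - y)" "psd (sc m + y)" "0 \<le> m"
  shows "p y \<le> m"
proof -
  have sa: "star y = y"
    using psd_self_adjoint[OF assms(2)] by (simp add: star_add)
  define z where "z = (sc m - y) * (sc m + y)"
  have z: "z = sc (m * m) - y * y"
    by (simp add: z_def algebra_simps sc_algebra)
  have zy: "z * y = y * z"
    unfolding z by (simp add: algebra_simps sc_algebra)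
  have "psd z"
    unfolding z_def using assms by (intro psd_mult) (auto simp: algebra_simps sc_algebra)
  have "(p y)\<^sup>2 \<le> m\<^sup>2 + e" if e: "0 < e" for e
  proof -
    obtain r where r: "star r = r" "\<And>b. z * b = b * z \<Longrightarrow> r * b = b * r" "p (r * r - z) \<le> e"
      using approx_sqrt[OF \<open>psd z\<close> e] by blast
    have "(p y)\<^sup>2 \<le> p (y * y + r * r)"
      using sa r(1) r(2)[OF zy] by (intro square_le_sum_squares) auto
    also have "y * y + r * r = (r * r - z) + sc (m * m)"
      unfolding z by simp
    also have "p \<dots> \<le> e + m\<^sup>2"
      using triangle[of "r * r - z" "sc (m * m)"] r(3) p_sc[of "m * m"]
      by (simp add: power2_eq_square)
    finally show ?thesis by simp
  qed
  then have "(p y)\<^sup>2 \<le> m\<^sup>2"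
    by (rule field_le_epsilon)
  then show ?thesis
    using assms(3) by (rule power2_le_imp_le)
qed

section \<open>Positivity of \<open>star c * c\<close>\<close>

text \<open>A form of \<open>spec (d\<^sup>* d) \<union> {0} = spec (d d\<^sup>*) \<union> {0}\<close>: the powers of \<open>L + d d\<^sup>*\<close> and of
  \<open>L + d\<^sup>* d\<close> have the same exponential growth.\<close>

lemma psd_swap:
  assumes "psd (sc m - star d * d)" "0 \<le> m"
  shows "psd (sc m - d * star d)"
  unfolding psd_def
proof (intro conjI allI impI)
  show "star (sc m - d * star d) = sc m - d * star d"
    by (simp add: star_diff star_mult star_star)
  fix e :: real
  assume "0 < e"
  obtain M where M: "M \<ge> m + 1" "p (sc M - (sc m - star d * d)) \<le> M + e"
    using psd_large[OF assms(1) \<open>0 < e\<close>] by metis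
  \<comment> \<open>With this shift \<open>A\<close> equals \<open>M - (m - d\<^sup>* d)\<close>,
    whose seminorm is at most \<open>M + e\<close>.\<close>
  define L where "L = M - m"
  define A where "A = sc L + star d * d"
  define B where "B = sc L + d * star d"
  define \<beta> where "\<beta> = M + e"
  define D where "D = (p d)\<^sup>2 / \<beta>"
  have \<beta>: "0 < \<beta>" "0 \<le> L" "L \<le> \<beta>" "0 \<le> D"
    using M assms(2) \<open>0 < e\<close> by (auto simp: \<beta>_def L_def D_def)
  have A: "p A \<le> \<beta>"
    using M(2) by (simp add: A_def L_def sc_diff \<beta>_def algebra_simps)
  have An: "p (A ^ n) \<le> \<beta> ^ n" for n
  proof (induction n)
    case (Suc n)
    show ?case
      using submult[of A "A ^ n"] mult_mono[OF A Suc] \<beta> by auto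
  qed (simp add: p_1)
  \<comment> \<open>The element \<open>d\<close> intertwines \<open>A\<close> and \<open>B\<close>;
    this transfers the power bound for \<open>A\<close> to \<open>B\<close>.\<close>
  have Bd: "B ^ n * d = d * A ^ n" for n
  proof (induction n)
    case (Suc n)
    have "B * d = d * A"
      by (simp add: A_def B_def algebra_simps sc_algebra)
    then show ?case
      using Suc by (metis mult.assoc power_Suc)
  qed simp
  have "p (B ^ n) \<le> \<beta> ^ n * (1 + real n * D)" for n
  proof (induction n)
    case (Suc n)
    \<comment> \<open>Expanding the last factor gives \<open>L\<close> times the previous power plus
      \<open>d A\<^sup>n d\<^sup>*\<close>; the second term contributes one more summand
      \<open>D\<close> to the linear factor.\<close>
    have "B ^ Suc n = B ^ n * B"
      by (rule power_Suc2)
    also have "\<dots> = sc L * B ^ n + d * A ^ n * star d"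
      by (subst (2) B_def) (simp add: distrib_left sc_algebra Bd flip: mult.assoc)
    finally have eq: "B ^ Suc n = sc L * B ^ n + d * A ^ n * star d" .
    have "p (d * A ^ n * star d) \<le> p d * p (A ^ n) * p d"
      using submult[of "d * A ^ n" "star d"] mult_right_mono[OF submult[of d "A ^ n"], of "p d"]
      by simp
    also have "\<dots> \<le> p d * \<beta> ^ n * p d"
      using An by (intro mult_right_mono mult_left_mono) auto
    finally have "p (B ^ Suc n) \<le> L * p (B ^ n) + (p d)\<^sup>2 * \<beta> ^ n"
      unfolding eq using triangle[of "sc L * B ^ n" "d * A ^ n * star d"] \<beta>
      by (simp add: p_sc_mult power2_eq_square mult_ac)
    also have "\<dots> \<le> \<beta> * (\<beta> ^ n * (1 + real n * D)) + (p d)\<^sup>2 * \<beta> ^ n"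
      using Suc \<beta> by (intro add_right_mono mult_mono) auto
    also have "(p d)\<^sup>2 = \<beta> * D"
      using \<beta> by (simp add: D_def)
    finally show ?case
      by (simp add: algebra_simps)
  qed (simp add: p_1)
  moreover have "star B = B"
    by (simp add: B_def star_add star_mult star_star)
  ultimately have "p B ^ (2 ^ k) \<le> \<beta> ^ (2 ^ k) * (1 + real (2 ^ k) * D)" for k
    by (metis p_power_two_power)
  then have "p B \<le> \<beta>"
    by (rule le_if_powers_le[OF \<beta>(1)])
  then show "\<exists>M\<ge>0. p (sc M - (sc m - d * star d)) \<le> M + e"
    using M assms(2) by (intro exI[of _ M]) (simp add: B_def L_def \<beta>_def sc_diff algebra_simps)
qed

text \<open>In the Cartesian decomposition \<open>d = h + i k\<close> the mixed terms cancel, and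
  the sum is \<open>2 (h\<^sup>2 + k\<^sup>2)\<close>.\<close>

lemma psd_sum_star_mult: "psd (star d * d + d * star d)"
proof -
  define h where "h = sc (1/2) * (d + star d)"
  define k where "k = (\<i>/2) *\<^sub>C (star d - d)"
  have "star h = h"
    by (simp add: h_def star_mult star_add star_star sc_algebra add.commute)
  moreover have "star k = k"
    by (simp add: k_def star_scaleC star_diff star_star scaleC_minus_left scaleC_diff_right)
  moreover have "star d * d + d * star d = (h * h + k * k) + (h * h + k * k)"
  proof -
    have hh: "h * h = (1/4) *\<^sub>C ((d + star d) * (d + star d))"
      by (simp add: h_def sc_def mult_scaleC_left mult_scaleC_right scaleC_scaleC)
    have kk: "k * k = (1/4) *\<^sub>C (- ((star d - d) * (star d - d)))"
    proof -
      have "(\<i>/2) * (\<i>/2) = - (1/4)"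
        by simp
      then show ?thesis
        unfolding k_def mult_scaleC_left mult_scaleC_right scaleC_scaleC
        by (simp only: scaleC_minus_left scaleC_minus_right)
    qed
    have "h * h + k * k = (1/4) *\<^sub>C ((star d * d + d * star d) + (star d * d + d * star d))"
      unfolding hh kk scaleC_add_right[symmetric]
      by (rule arg_cong[of _ _ "\<lambda>a. (1/4) *\<^sub>C a"]) (simp add: algebra_simps)
    also have "\<dots> = (1/2) *\<^sub>C (star d * d + d * star d)"
      unfolding scaleC_add_right[of _ "star d * d + d * star d"] scaleC_add_left[symmetric] by simp
    finally show ?thesis
      by (simp only: scaleC_add_left[symmetric]) (simp add: scaleC_one)
  qed
  ultimately show ?thesis
    by (metis psd_add psd_square)
qed

text \<open>\<open>psd_swap\<close> carries the bound over to \<open>d * star d\<close>; adding the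
  positive \<open>star d * d + d * star d\<close> then yields the lower bound that
  \<open>bound_if_psd\<close> requires. Positivity of \<open>star d * d\<close> is not presupposed,
  since this estimate serves to prove it.\<close>

lemma star_mult_self_le:
  assumes "psd (sc m - star d * d)" "0 \<le> m"
  shows "p (star d * d) \<le> m"
proof (rule bound_if_psd[OF assms(1) _ assms(2)])
  have "psd ((sc m - d * star d) + (star d * d + d * star d))"
    using psd_swap[OF assms] psd_sum_star_mult by (rule psd_add)
  then show "psd (sc m + star d * d)"
    by (simp add: algebra_simps)
qed

text \<open>For \<open>x = c\<^sup>* c\<close> and \<open>v = 1 - x\<close>, the preceding lemma applied to \<open>d = c v\<^sup>n\<close> bounds
  \<open>x v\<^sup>2\<^sup>n\<close>, because \<open>1 - x v\<^sup>N = (v - 1) (v\<^sup>N - 1) + v\<close> is positive. As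
  \<open>v\<^sup>n - v\<^sup>n\<^sup>+\<^sup>1 = x v\<^sup>n\<close>, the powers of \<open>v\<close> grow at most linearly, whence \<open>p v \<le> 1\<close>.\<close>

lemma psd_star_mult_self_if_le_1:
  assumes "p (star c * c) \<le> 1"
  shows "psd (star c * c)"
proof -
  define x where "x = star c * c"
  define v where "v = 1 - x"
  have sax: "star x = x"
    by (simp add: x_def star_mult star_star)
  then have sav: "star v = v"
    by (simp add: v_def star_diff star_1)
  have star_vn: "star (v ^ n) = v ^ n" for n
    by (induction n) (simp_all add: star_1 star_mult sav power_commutes)
  have psdv: "psd v"
    using psd_bound[OF sax, of 1] assms by (simp add: v_def x_def)
  have xv: "x = 1 - v"
    by (simp add: v_def)
  have comm: "x * v ^ n = v ^ n * x" for n
    by (simp add: xv algebra_simps power_commutes)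
  \<comment> \<open>The product \<open>(v - 1) (v\<^sup>N - 1)\<close> is the geometric sum times
    \<open>(v - 1)\<^sup>2\<close>, a product of commuting positive elements.\<close>
  have psd1: "psd (1 - x * v ^ N)" for N
  proof -
    have "(\<Sum>i<N. v ^ i) * v = v * (\<Sum>i<N. v ^ i)"
      by (simp only: sum_distrib_left sum_distrib_right power_commutes)
    then have gv: "(\<Sum>i<N. v ^ i) * (v - 1) = (v - 1) * (\<Sum>i<N. v ^ i)"
      by (simp add: algebra_simps)
    have geom: "(v - 1) * (\<Sum>i<N. v ^ i) = v ^ N - 1"
      by (induction N) (simp_all add: algebra_simps)
    have "(\<Sum>i<N. v ^ i) * ((v - 1) * (v - 1)) = (v - 1) * (v - 1) * (\<Sum>i<N. v ^ i)"
      by (simp only: mult.assoc[symmetric] gv) (simp only: mult.assoc gv)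
    moreover have "psd ((v - 1) * (v - 1))"
      by (rule psd_square) (simp add: star_diff star_1 sav)
    moreover have "psd (\<Sum>i<N. v ^ i)"
      by (rule psd_sum) (rule psd_power[OF psdv])
    ultimately have "psd ((\<Sum>i<N. v ^ i) * ((v - 1) * (v - 1)) + v)"
      by (intro psd_add psdv psd_mult[of "\<Sum>i<N. v ^ i"])
    also have "(\<Sum>i<N. v ^ i) * ((v - 1) * (v - 1)) = (v ^ N - 1) * (v - 1)"
      by (simp only: mult.assoc[symmetric] gv geom)
    also have "(v ^ N - 1) * (v - 1) + v = 1 - x * v ^ N"
      by (simp add: comm) (simp add: xv algebra_simps)
    finally show ?thesis .
  qed
  have even: "p (x * v ^ (2 * n)) \<le> 1" for n
  proof -
    have "star (c * v ^ n) * (c * v ^ n) = v ^ n * x * v ^ n"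
      by (simp add: star_mult star_vn x_def mult.assoc)
    also have "\<dots> = x * v ^ (2 * n)"
      by (simp add: mult.assoc mult_2 power_add flip: comm)
    finally have eq: "star (c * v ^ n) * (c * v ^ n) = x * v ^ (2 * n)" .
    show ?thesis
      using star_mult_self_le[of 1 "c * v ^ n"] psd1[of "2 * n"] by (simp add: eq)
  qed
  have pv2: "p v \<le> 2"
    using triangle_diff[of 1 x] p_1 assms by (simp add: v_def x_def)
  have bnd: "p (x * v ^ n) \<le> 2" for n
  proof (cases "even n")
    case True
    then show ?thesis
      using even[of "n div 2"] by simp
  next
    case False
    then obtain k where k: "n = 2 * k + 1"
      by (auto elim: oddE)
    have "x * v ^ n = x * v ^ (2 * k) * v"
      by (simp add: k mult.assoc power_commutes)
    then have "p (x * v ^ n) \<le> p (x * v ^ (2 * k)) * p v"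
      using submult by metis
    also have "\<dots> \<le> 1 * 2"
      using even[of k] pv2 by (intro mult_mono) auto
    finally show ?thesis by simp
  qed
  have lin: "p (v ^ n) \<le> 1 + real n * 2" for n
  proof (induction n)
    case (Suc n)
    have "v ^ Suc n = v ^ n - x * v ^ n"
      by (simp add: xv algebra_simps)
    then have "p (v ^ Suc n) \<le> p (v ^ n) + p (x * v ^ n)"
      using triangle_diff by metis
    then show ?case
      using Suc bnd[of n] by simp
  qed (simp add: p_1)
  have "p v \<le> 1"
  proof (rule le_if_powers_le[where D = 2])
    fix k
    show "p v ^ 2 ^ k \<le> 1 ^ 2 ^ k * (1 + real (2 ^ k) * 2)"
      using lin[of "2 ^ k"] by (simp add: p_power_two_power[OF sav])
  qed simp
  then show ?thesis
    using psd_bound[OF sav, of 1] by (simp add: v_def x_def)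
qed

text \<open>Scaling by \<open>1/t\<close> reduces this to the preceding lemma, and scaling back is
  multiplication by the square \<open>t\<^sup>2\<close>. The summand 1 in \<open>t\<close> keeps it
  nonzero when \<open>p c\<close> vanishes.\<close>

lemma psd_star_mult_self: "psd (star c * c)"
proof -
  define t where "t = p c + 1"
  have t: "0 < t" "p c \<le> t"
    using nonneg[of c] by (simp_all add: t_def add_nonneg_pos)
  define d where "d = sc (1/t) * c"
  have dd: "star d * d = sc ((1/t) * (1/t)) * (star c * c)"
    unfolding sc_mult by (simp add: d_def star_mult mult.assoc sc_algebra)
  have "p d \<le> 1"
    using t by (simp add: d_def p_sc_mult)
  then have "psd (star d * d)"
    by (intro psd_star_mult_self_if_le_1) (simp add: cstar_id power_le_one)
  moreover have "psd (sc t * sc t)"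
    by (intro psd_square) simp
  ultimately have "psd ((sc t * sc t) * (star d * d))"
    by (intro psd_mult[of "sc t * sc t"]) (simp_all add: mult.assoc sc_algebra)
  also have "(sc t * sc t) * (star d * d) = star c * c"
    using t unfolding dd by (simp flip: sc_mult mult.assoc)
  finally show ?thesis .
qed

text \<open>With \<open>k = b\<^sup>* b + c\<^sup>* c\<close>, the difference
  \<open>p k - b\<^sup>* b = (p k - k) + c\<^sup>* c\<close> is a sum of positive elements, and
  \<open>star_mult_self_le\<close> turns this into a bound on the seminorm.\<close>

lemma positive_mono_unital: "p (star b * b) \<le> p (star b * b + star c * c)"
proof (rule star_mult_self_le)
  define k where "k = star b * b + star c * c"
  have "psd (sc (p k) - k)"
    by (rule psd_bound) (auto simp: k_def star_add star_mult star_star)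
  then have "psd ((sc (p k) - k) + star c * c)"
    by (rule psd_add) (rule psd_star_mult_self)
  then show "psd (sc (p (star b * b + star c * c)) - star b * b)"
    by (simp add: k_def algebra_simps)
qed simp

end

subsection \<open>Unitization\<close>

text \<open>A pair stands for the formal sum of a multiple of a new unit and an element of the
  algebra.\<close>

datatype 'a unitization = Unitization (scal: complex) (elt: 'a)

instantiation unitization :: (complex_star_algebra) "{complex_star_algebra, ring_1}"
begin

definition "0 = Unitization 0 0"
definition "1 = Unitization 1 0"
definition "u + v = Unitization (scal u + scal v) (elt u + elt v)"
definition "- u = Unitization (- scal u) (- elt u)"
definition "u - v = Unitization (scal u - scal v) (elt u - elt v)"
definition "u * v = Unitization (scal u * scal v)
  (scal u *\<^sub>C elt v + scal v *\<^sub>C elt u + elt u * elt v)"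
definition "c *\<^sub>C u = Unitization (c * scal u) (c *\<^sub>C elt u)"
definition "star u = Unitization (cnj (scal u)) (star (elt u))"

lemmas unitization_defs = zero_unitization_def one_unitization_def plus_unitization_def
  uminus_unitization_def minus_unitization_def times_unitization_def scaleC_unitization_def
  star_unitization_def

instance
  by standard
    (auto simp: unitization_defs algebra_simps scaleC_add_left scaleC_add_right scaleC_scaleC
      scaleC_one mult_scaleC_left mult_scaleC_right star_add star_scaleC star_mult star_star)

end

section \<open>Extension of a C*-seminorm to the unitization\<close>

context cstar_seminormed
begin

definition act :: "'a unitization \<Rightarrow> 'a \<Rightarrow> 'a" where
  "act u x = scal u *\<^sub>C x + elt u * x"

text \<open>This is the operator seminorm of left multiplication by \<open>u\<close> on the original
  algebra. The sum of the seminorms of both components would in general violate the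
  C*-identity.\<close>

definition unorm :: "'a unitization \<Rightarrow> real" where
  "unorm u = (SUP x\<in>{x. p x \<le> 1}. p (act u x))"

lemma act_add: "act (u + v) x = act u x + act v x"
  by (simp add: act_def plus_unitization_def scaleC_add_left distrib_right)

lemma act_mult: "act (u * v) x = act u (act v x)"
  by (simp add: act_def times_unitization_def algebra_simps scaleC_add_right scaleC_scaleC
      mult_scaleC_left mult_scaleC_right)

lemma act_scaleC: "act (c *\<^sub>C u) x = c *\<^sub>C act u x"
  by (simp add: act_def scaleC_unitization_def scaleC_add_right scaleC_scaleC mult_scaleC_left)

lemma act_scaleC_right: "act u (c *\<^sub>C x) = c *\<^sub>C act u x"
  by (simp add: act_def scaleC_add_right scaleC_scaleC mult_scaleC_right mult.commute)

lemma star_act: "star (act u x) * act u x = star x * act (star u * u) x"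
  by (simp add: act_def star_unitization_def times_unitization_def star_add star_scaleC star_mult
      algebra_simps scaleC_add_right scaleC_scaleC mult_scaleC_left mult_scaleC_right)

lemma act_bound: "p (act u x) \<le> (cmod (scal u) + p (elt u)) * p x"
  using triangle[of "scal u *\<^sub>C x" "elt u * x"] submult[of "elt u" x]
  by (simp add: act_def scale distrib_right)

lemma act_le_unorm1:
  assumes "p x \<le> 1"
  shows "p (act u x) \<le> unorm u"
  unfolding unorm_def
proof (rule cSUP_upper)
  show "bdd_above ((\<lambda>x. p (act u x)) ` {x. p x \<le> 1})"
  proof (rule bdd_aboveI2)
    fix z
    assume "z \<in> {x. p x \<le> 1}"
    then show "p (act u z) \<le> cmod (scal u) + p (elt u)"
      using act_bound[of u z] mult_left_mono[of "p z" 1 "cmod (scal u) + p (elt u)"] by simp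
  qed
qed (use assms in simp)

lemma unorm_nonneg: "0 \<le> unorm u"
  using act_le_unorm1[of 0 u] by (simp add: act_def)

text \<open>Normalizing \<open>x\<close> settles the case of nonzero \<open>p x\<close>; otherwise
  \<open>act_bound\<close> shows that \<open>u\<close> maps the kernel of \<open>p\<close> into
  itself.\<close>

lemma act_le_unorm: "p (act u x) \<le> unorm u * p x"
proof (cases "p x = 0")
  case True
  then show ?thesis
    using act_bound[of u x] by simp
next
  case False
  then have x: "0 < p x"
    using nonneg[of x] by linarith
  define y where "y = complex_of_real (1 / p x) *\<^sub>C x"
  have "p y = 1"
    using x by (simp add: y_def scale norm_divide)
  then have "p (act u y) \<le> unorm u"
    by (intro act_le_unorm1) simp
  then show ?thesis
    using x by (simp add: y_def act_scaleC_right scale norm_divide field_simps)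
qed

lemma unorm_least:
  assumes "\<And>x. p (act u x) \<le> C * p x" "0 \<le> C"
  shows "unorm u \<le> C"
  unfolding unorm_def
proof (rule cSUP_least)
  show "{x. p x \<le> 1} \<noteq> {}"
    by (auto intro: exI[of _ 0])
  fix x
  assume "x \<in> {x. p x \<le> 1}"
  then show "p (act u x) \<le> C"
    using assms(1)[of x] mult_left_mono[of "p x" 1 C] assms(2) by simp
qed

lemma unorm_mult: "unorm (u * v) \<le> unorm u * unorm v"
proof (rule unorm_least)
  fix x
  have "p (act (u * v) x) \<le> unorm u * p (act v x)"
    unfolding act_mult by (rule act_le_unorm)
  also have "\<dots> \<le> unorm u * (unorm v * p x)"
    by (intro mult_left_mono act_le_unorm unorm_nonneg)
  finally show "p (act (u * v) x) \<le> unorm u * unorm v * p x"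
    by (simp add: mult.assoc)
qed (simp add: unorm_nonneg)

text \<open>The C*-identity of \<open>p\<close> rewrites \<open>(p (u x))\<^sup>2\<close> as
  \<open>p (x\<^sup>* (u\<^sup>* u x))\<close>, which is at most
  \<open>unorm (star u * u) * (p x)\<^sup>2\<close>.\<close>

lemma unorm_square_le: "(unorm u)\<^sup>2 \<le> unorm (star u * u)"
proof -
  have "unorm u \<le> sqrt (unorm (star u * u))"
  proof (rule unorm_least)
    fix x
    have "(p (act u x))\<^sup>2 = p (star x * act (star u * u) x)"
      by (simp add: star_act flip: cstar_id)
    also have "\<dots> \<le> p x * p (act (star u * u) x)"
      using submult[of "star x"] by simp
    also have "\<dots> \<le> p x * (unorm (star u * u) * p x)"
      by (intro mult_left_mono act_le_unorm) simp
    also have "\<dots> = (sqrt (unorm (star u * u)) * p x)\<^sup>2"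
      by (simp add: power_mult_distrib unorm_nonneg power2_eq_square)
    finally show "p (act u x) \<le> sqrt (unorm (star u * u)) * p x"
      by (rule power2_le_imp_le) (simp add: unorm_nonneg)
  qed (simp add: unorm_nonneg)
  then show ?thesis
    using unorm_nonneg by (metis real_sqrt_le_iff real_sqrt_unique sqrt_le_D)
qed

lemma unorm_star_le: "unorm (star u) \<le> unorm u"
proof (cases "unorm (star u) = 0")
  case False
  have "unorm (star u) * unorm (star u) \<le> unorm u * unorm (star u)"
    using unorm_square_le[of "star u"] unorm_mult[of u "star u"]
    by (simp add: star_star power2_eq_square)
  then show ?thesis
    using False unorm_nonneg[of "star u"] by (simp add: mult_le_cancel_right)
qed (simp add: unorm_nonneg)

lemma cstar_seminorm_unorm: "cstar_seminorm unorm"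
  unfolding cstar_seminorm_def
proof (intro conjI allI)
  fix u v :: "'a unitization" and c :: complex
  show "0 \<le> unorm u"
    by (rule unorm_nonneg)
  show "unorm (u * v) \<le> unorm u * unorm v"
    by (rule unorm_mult)
  show "unorm (u + v) \<le> unorm u + unorm v"
  proof (rule unorm_least)
    fix x
    show "p (act (u + v) x) \<le> (unorm u + unorm v) * p x"
      using triangle[of "act u x" "act v x"] act_le_unorm[of u x] act_le_unorm[of v x]
      by (simp add: act_add distrib_right)
  qed (simp add: unorm_nonneg)
  \<comment> \<open>The reverse inequality comes from this one for the scalar
    \<open>1 / c\<close>.\<close>
  have le: "unorm (c *\<^sub>C u) \<le> cmod c * unorm u" for c u
  proof (rule unorm_least)
    fix x
    show "p (act (c *\<^sub>C u) x) \<le> cmod c * unorm u * p x"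
      using mult_left_mono[OF act_le_unorm[of u x], of "cmod c"]
      by (simp add: act_scaleC scale mult.assoc)
  qed (simp add: unorm_nonneg)
  show "unorm (c *\<^sub>C u) = cmod c * unorm u"
  proof (cases "c = 0")
    case True
    then show ?thesis
      using le[of 0 u] unorm_nonneg[of "0 *\<^sub>C u"] by simp
  next
    case False
    then have "cmod c * unorm u \<le> cmod c * (cmod (1 / c) * unorm (c *\<^sub>C u))"
      using le[of "1 / c" "c *\<^sub>C u"] by (intro mult_left_mono) (simp_all add: scaleC_scaleC scaleC_one)
    then show ?thesis
      using le[of c u] False by (simp add: norm_divide)
  qed
  have "unorm (star u * u) \<le> unorm u * unorm u"
    using unorm_mult[of "star u" u] mult_right_mono[OF unorm_star_le[of u] unorm_nonneg[of u]]
    by linarith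
  then show "unorm (star u * u) = (unorm u)\<^sup>2"
    using unorm_square_le[of u] by (simp add: power2_eq_square)
qed

lemma unorm_elt: "unorm (Unitization 0 a) = p a"
proof (rule antisym)
  show "unorm (Unitization 0 a) \<le> p a"
    by (rule unorm_least) (simp_all add: act_def submult)
  show "p a \<le> unorm (Unitization 0 a)"
  proof (cases "p a = 0")
    case False
    \<comment> \<open>The test element \<open>star a\<close> attains the bound, by the
      C*-identity.\<close>
    have "p a * p a \<le> unorm (Unitization 0 a) * p a"
      using act_le_unorm[of "Unitization 0 a" "star a"] cstar_id[of "star a"]
      by (simp add: act_def star_star power2_eq_square)
    then show ?thesis
      using False nonneg[of a] by (simp add: mult_le_cancel_right)
  qed (simp add: unorm_nonneg)
qed

text \<open>The embedding into the unitization respects sums, products, the involution and the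
  seminorm, so the unital case carries over.\<close>

lemma positive_mono: "p (star b * b) \<le> p (star b * b + star c * c)"
proof -
  interpret unitization: unital_cstar_seminormed unorm
    by unfold_locales (rule cstar_seminorm_unorm)
  show ?thesis
    using unitization.positive_mono_unital[of "Unitization 0 b" "Unitization 0 c"]
    by (simp add: unitization_defs unorm_elt)
qed

end

subsection \<open>Hilbert modules\<close>

lemma cstar_seminormed_Se: "p \<in> Se \<Longrightarrow> cstar_seminormed p"
  by (simp add: Se_def cstar_seminormed_def)

text \<open>If all these seminorms vanish at \<open>a\<close>, the pair \<open>(0, a)\<close> lies
  in every entourage, so every open set around 0 contains \<open>a\<close>; separation forces
  \<open>a = 0\<close>.\<close>

lemma eq_0_if_Se:
  fixes a :: "'a::pro_cstar_algebra"
  assumes "\<And>p. p \<in> Se \<Longrightarrow> p a = 0"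
  shows "a = 0"
proof (rule ccontr)
  assume "a \<noteq> 0"
  then obtain W where W: "open W" "0 \<in> W" "a \<notin> W"
    by (metis t1_space)
  have "eventually (\<lambda>(x, y). x = 0 \<longrightarrow> y \<in> W) uniformity"
    using W by (simp add: open_uniformity)
  moreover have "principal {(0, a)} \<le> (uniformity :: ('a \<times> 'a) filter)"
    unfolding uniformity_Se
  proof (intro INF_greatest)
    fix p :: "'a \<Rightarrow> real" and e :: real
    assume "p \<in> Se" "e \<in> {0<..}"
    interpret cstar_seminormed p
      using \<open>p \<in> Se\<close> by (rule cstar_seminormed_Se)
    show "principal {(0, a)} \<le> principal {(x, y). p (x - y) < e}"
      using assms[OF \<open>p \<in> Se\<close>] \<open>e \<in> {0<..}\<close> by simp
  qed
  ultimately have "eventually (\<lambda>(x, y). x = 0 \<longrightarrow> y \<in> W) (principal {(0 :: 'a, a)})"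
    by (simp add: le_filter_def)
  then show False
    using W by (simp add: eventually_principal)
qed

context hilbert_module
begin

lemma iprod_zero_left: "y \<in> carrier M \<Longrightarrow> iprod M \<zero> y = 0"
  using iprod_add_left[of \<zero> \<zero> y] by simp

lemma iprod_minus_left:
  "\<lbrakk>x \<in> carrier M; y \<in> carrier M\<rbrakk> \<Longrightarrow> iprod M (\<ominus> x) y = - iprod M x y"
  using iprod_add_left[of "\<ominus> x" x y] by (simp add: l_neg iprod_zero_left eq_neg_iff_add_eq_0)

lemma iprod_diff_left:
  "\<lbrakk>x \<in> carrier M; y \<in> carrier M; z \<in> carrier M\<rbrakk> \<Longrightarrow>
    iprod M (x \<ominus> y) z = iprod M x z - iprod M y z"
  by (simp add: minus_eq iprod_add_left iprod_minus_left)

lemma iprod_add_right: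
  "\<lbrakk>x \<in> carrier M; y \<in> carrier M; z \<in> carrier M\<rbrakk> \<Longrightarrow>
    iprod M z (x \<oplus> y) = iprod M z x + iprod M z y"
  using iprod_add_left[of x y z] star_iprod by (metis add.m_closed star_add)

lemma iprod_diff_right:
  "\<lbrakk>x \<in> carrier M; y \<in> carrier M; z \<in> carrier M\<rbrakk> \<Longrightarrow>
    iprod M z (x \<ominus> y) = iprod M z x - iprod M z y"
  using iprod_diff_left[of x y z] star_iprod by (metis minus_closed star_diff)

lemma eq_if_diff_eq_0:
  assumes "x \<ominus> y = \<zero>" "x \<in> carrier M" "y \<in> carrier M"
  shows "x = y"
  using minus_equality[of x "\<ominus> y"] assms by (simp add: minus_eq)

lemma eq_if_iprod_eq:
  assumes z: "z \<in> carrier M" "z' \<in> carrier M"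
    and eq: "\<And>x. x \<in> carrier M \<Longrightarrow> iprod M x z = iprod M x z'"
  shows "z = z'"
proof -
  have "iprod M (z \<ominus> z') (z \<ominus> z') = 0"
    using z eq[of "z \<ominus> z'"] by (simp add: iprod_diff_right)
  then have "z \<ominus> z' = \<zero>"
    using z by (simp add: iprod_eq_0_iff)
  then show ?thesis
    using z by (rule eq_if_diff_eq_0)
qed

lemma pbar_square: "p \<in> Se \<Longrightarrow> (pbar M p x)\<^sup>2 = p (iprod M x x)"
  using cstar_seminormed.nonneg[OF cstar_seminormed_Se] by (simp add: pbar_def)

lemma pbar_nonneg: "p \<in> Se \<Longrightarrow> 0 \<le> pbar M p x"
  using cstar_seminormed.nonneg[OF cstar_seminormed_Se] by (simp add: pbar_def)

text \<open>The parallelogram law replaces the Cauchy-Schwarz inequality.\<close>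

lemma pbar_diff_square_le:
  assumes p: "p \<in> Se" and x: "x \<in> carrier M" and y: "y \<in> carrier M"
  shows "(pbar M p (x \<ominus> y))\<^sup>2 \<le> 2 * (pbar M p x)\<^sup>2 + 2 * (pbar M p y)\<^sup>2"
proof -
  interpret cstar_seminormed p
    using p by (rule cstar_seminormed_Se)
  obtain b where b: "iprod M (x \<ominus> y) (x \<ominus> y) = star b * b"
    using positive_iprod[of "x \<ominus> y"] x y by (auto simp: positive_def)
  obtain c where c: "iprod M (x \<oplus> y) (x \<oplus> y) = star c * c"
    using positive_iprod[of "x \<oplus> y"] x y by (auto simp: positive_def)
  have "star b * b + star c * c
      = (iprod M x x + iprod M x x) + (iprod M y y + iprod M y y)"
    unfolding b[symmetric] c[symmetric] using x y
    by (simp add: iprod_diff_left iprod_diff_right iprod_add_left iprod_add_right)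
  then have "p (star b * b)
      \<le> p ((iprod M x x + iprod M x x) + (iprod M y y + iprod M y y))"
    by (metis positive_mono)
  also have "\<dots> \<le> p (iprod M x x) + p (iprod M x x) + (p (iprod M y y) + p (iprod M y y))"
    by (intro order_trans[OF triangle] add_mono triangle)
  finally show ?thesis
    using p by (simp add: pbar_square b)
qed

lemma eq_if_pbar_diff_eq_0:
  assumes "x \<in> carrier M" "y \<in> carrier M" "\<And>p. p \<in> Se \<Longrightarrow> pbar M p (x \<ominus> y) = 0"
  shows "x = y"
proof -
  have "iprod M (x \<ominus> y) (x \<ominus> y) = 0"
    by (rule eq_0_if_Se) (metis assms(3) pbar_square zero_power2)
  then have "x \<ominus> y = \<zero>"
    using assms by (simp add: iprod_eq_0_iff)
  then show ?thesis
    using assms(1,2) by (rule eq_if_diff_eq_0)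
qed

text \<open>For every partial sum \<open>z F\<close>, the difference of \<open>s\<close> and
  \<open>t\<close> is that of the errors of \<open>z F\<close> against \<open>t\<close> and
  \<open>s\<close>. Its squared seminorm is bounded by twice the sum of the squared errors, which
  tends to 0.\<close>

lemma has_sum_in_unique:
  assumes f: "f \<in> I \<rightarrow> carrier M" and s: "s \<in> carrier M" "t \<in> carrier M"
    and hs: "has_sum_in M f s I" and ht: "has_sum_in M f t I"
  shows "s = t"
proof (rule eq_if_pbar_diff_eq_0[OF s])
  fix p :: "'a \<Rightarrow> real"
  assume p: "p \<in> Se"
  define z where "z F = (\<Oplus>i\<in>F. f i)" for F
  have "((\<lambda>F. 2 * (pbar M p (z F \<ominus> t))\<^sup>2 + 2 * (pbar M p (z F \<ominus> s))\<^sup>2) \<longlongrightarrow> 2 * 0\<^sup>2 + 2 * 0\<^sup>2)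
      (finite_subsets_at_top I)"
    using hs ht p unfolding has_sum_in_def z_def by (intro tendsto_intros) auto
  moreover have "eventually (\<lambda>F. (pbar M p (s \<ominus> t))\<^sup>2
      \<le> 2 * (pbar M p (z F \<ominus> t))\<^sup>2 + 2 * (pbar M p (z F \<ominus> s))\<^sup>2) (finite_subsets_at_top I)"
  proof (rule eventually_finite_subsets_at_top_weakI)
    fix F
    assume "finite F" "F \<subseteq> I"
    then have z: "z F \<in> carrier M"
      unfolding z_def using f by (intro finsum_closed) auto
    have "(z F \<ominus> t) \<ominus> (z F \<ominus> s) = s \<ominus> t"
      using z s by (simp add: minus_eq minus_add a_ac r_neg1)
        (metis a_assoc a_comm a_inv_closed a_closed r_neg2 minus_minus)
    then show "(pbar M p (s \<ominus> t))\<^sup>2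
        \<le> 2 * (pbar M p (z F \<ominus> t))\<^sup>2 + 2 * (pbar M p (z F \<ominus> s))\<^sup>2"
      using pbar_diff_square_le[OF p, of "z F \<ominus> t" "z F \<ominus> s"] z s by simp
  qed
  ultimately have "(pbar M p (s \<ominus> t))\<^sup>2 \<le> 2 * 0\<^sup>2 + 2 * 0\<^sup>2"
    by (rule tendsto_lowerbound) simp
  then show "pbar M p (s \<ominus> t) = 0"
    by simp
qed

end

section \<open>Adjointable maps and their adjoints\<close>

lemma hom_star_closed: "\<lbrakk>T \<in> hom_star U V; x \<in> carrier U\<rbrakk> \<Longrightarrow> T x \<in> carrier V"
  by (auto simp: hom_star_def)

lemma hom_star_add:
  "\<lbrakk>T \<in> hom_star U V; x \<in> carrier U; y \<in> carrier U\<rbrakk> \<Longrightarrow>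
    T (x \<oplus>\<^bsub>U\<^esub> y) = T x \<oplus>\<^bsub>V\<^esub> T y"
  by (simp add: hom_star_def)

locale hilbert_module_pair = U: hilbert_module U + V: hilbert_module V
  for U :: "('a::pro_cstar_algebra, 'u) hilbert_mod"
    and V :: "('a, 'v) hilbert_mod"
begin

lemma adj_unique:
  assumes "z \<in> carrier U" "\<And>x. x \<in> carrier U \<Longrightarrow> iprod V (T x) y = iprod U x z"
  shows "adj U V T y = z"
  unfolding adj_def
proof (rule the_equality)
  fix z'
  assume "z' \<in> carrier U \<and> (\<forall>x\<in>carrier U. iprod V (T x) y = iprod U x z')"
  then show "z' = z"
    using assms by (intro U.eq_if_iprod_eq) auto
qed (use assms in auto)

lemma adj_props:
  assumes T: "T \<in> hom_star U V" and y: "y \<in> carrier V"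
  shows adj_closed: "adj U V T y \<in> carrier U"
    and iprod_adj: "x \<in> carrier U \<Longrightarrow> iprod V (T x) y = iprod U x (adj U V T y)"
proof -
  obtain S where S: "S \<in> carrier V \<rightarrow> carrier U"
      "\<And>x y. \<lbrakk>x \<in> carrier U; y \<in> carrier V\<rbrakk> \<Longrightarrow> iprod V (T x) y = iprod U x (S y)"
    using T by (auto simp: hom_star_def)
  then have "adj U V T y = S y"
    using y by (intro adj_unique) auto
  then show "adj U V T y \<in> carrier U"
      "x \<in> carrier U \<Longrightarrow> iprod V (T x) y = iprod U x (adj U V T y)"
    using S y by auto
qed

lemma iprod_adj':
  assumes "T \<in> hom_star U V" "y \<in> carrier V" "x \<in> carrier U"
  shows "iprod V y (T x) = iprod U (adj U V T y) x"
  using iprod_adj[OF assms] assms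
  by (metis U.star_iprod V.star_iprod adj_closed hom_star_closed)

lemma hom_star_zero:
  assumes "T \<in> hom_star U V"
  shows "T \<zero>\<^bsub>U\<^esub> = \<zero>\<^bsub>V\<^esub>"
proof -
  have "T \<zero>\<^bsub>U\<^esub> \<oplus>\<^bsub>V\<^esub> T \<zero>\<^bsub>U\<^esub> = T \<zero>\<^bsub>U\<^esub>"
    using hom_star_add[OF assms, of "\<zero>\<^bsub>U\<^esub>" "\<zero>\<^bsub>U\<^esub>"] by simp
  then show ?thesis
    using hom_star_closed[OF assms U.zero_closed] by (metis V.add.r_cancel_one)
qed

lemma hom_star_minus:
  assumes "T \<in> hom_star U V" "x \<in> carrier U"
  shows "T (\<ominus>\<^bsub>U\<^esub> x) = \<ominus>\<^bsub>V\<^esub> T x"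
proof -
  have "T (\<ominus>\<^bsub>U\<^esub> x) \<oplus>\<^bsub>V\<^esub> T x = \<zero>\<^bsub>V\<^esub>"
    using hom_star_add[OF assms(1), of "\<ominus>\<^bsub>U\<^esub> x" x] assms
    by (simp add: U.l_neg hom_star_zero)
  then show ?thesis
    using assms by (simp add: V.minus_equality hom_star_closed)
qed

lemma hom_star_diff:
  assumes "T \<in> hom_star U V" "x \<in> carrier U" "y \<in> carrier U"
  shows "T (x \<ominus>\<^bsub>U\<^esub> y) = T x \<ominus>\<^bsub>V\<^esub> T y"
  using assms by (simp add: U.minus_eq V.minus_eq hom_star_add hom_star_minus)

lemma hom_star_finsum:
  assumes "T \<in> hom_star U V" "finite F" "f \<in> F \<rightarrow> carrier U"
  shows "T (\<Oplus>\<^bsub>U\<^esub>i\<in>F. f i) = (\<Oplus>\<^bsub>V\<^esub>i\<in>F. T (f i))"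
  using assms(2,3)
proof (induction F)
  case (insert i F)
  then have f: "f i \<in> carrier U" "f \<in> F \<rightarrow> carrier U"
    by auto
  then have "(\<lambda>i. T (f i)) \<in> F \<rightarrow> carrier V"
    using hom_star_closed[OF assms(1)] by auto
  then show ?case
    using insert f by (simp add: hom_star_add[OF assms(1)] hom_star_closed[OF assms(1)]
        U.finsum_closed)
qed (simp add: hom_star_zero[OF assms(1)])

end

section \<open>Convergent sums and their images under bounded maps\<close>

lemma has_sum_in_cong:
  assumes "hilbert_module M" "f \<in> I \<rightarrow> carrier M" "\<And>i. i \<in> I \<Longrightarrow> f i = g i"
  shows "has_sum_in M f s I \<longleftrightarrow> has_sum_in M g s I"
proof -
  interpret hilbert_module M by fact
  have "(\<Oplus>\<^bsub>M\<^esub>i\<in>F. f i) = (\<Oplus>\<^bsub>M\<^esub>i\<in>F. g i)" if "F \<subseteq> I" for F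
    using that assms(2,3) by (intro finsum_cong') (auto simp: Pi_def subset_iff)
  then have eq: "eventually (\<lambda>F. pbar M p ((\<Oplus>\<^bsub>M\<^esub>i\<in>F. f i) \<ominus>\<^bsub>M\<^esub> s)
      = pbar M p ((\<Oplus>\<^bsub>M\<^esub>i\<in>F. g i) \<ominus>\<^bsub>M\<^esub> s)) (finite_subsets_at_top I)" for p
    by (intro eventually_finite_subsets_at_top_weakI) simp
  then show ?thesis
    unfolding has_sum_in_def by (simp add: filterlim_cong[OF refl refl eq])
qed

text \<open>By additivity the error of a partial sum of the images is the image of the error, and
  boundedness compares their seminorms.\<close>

lemma has_sum_in_bounded_image:
  fixes U :: "('a::pro_cstar_algebra, 'u) hilbert_mod" and V :: "('a, 'v) hilbert_mod"
  assumes U: "hilbert_module U" and V: "hilbert_module V"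
    and T: "T \<in> hom_star U V" "bounded_op U V T"
    and f: "f \<in> I \<rightarrow> carrier U" "s \<in> carrier U" "has_sum_in U f s I"
  shows "has_sum_in V (\<lambda>i. T (f i)) (T s) I"
  unfolding has_sum_in_def
proof
  interpret hilbert_module_pair U V
    using U V by (rule hilbert_module_pair.intro)
  fix p :: "'a \<Rightarrow> real"
  assume p: "p \<in> Se"
  obtain C where C: "\<And>x. x \<in> carrier U \<Longrightarrow> pbar V p (T x) \<le> C * pbar U p x"
    using T(2) p unfolding bounded_op_def by meson
  have lim: "((\<lambda>F. C * pbar U p ((\<Oplus>\<^bsub>U\<^esub>i\<in>F. f i) \<ominus>\<^bsub>U\<^esub> s)) \<longlongrightarrow> 0) (finite_subsets_at_top I)"
    using f(3) p unfolding has_sum_in_def by (intro tendsto_mult_right_zero) auto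
  have "eventually (\<lambda>F. norm (pbar V p ((\<Oplus>\<^bsub>V\<^esub>i\<in>F. T (f i)) \<ominus>\<^bsub>V\<^esub> T s))
      \<le> C * pbar U p ((\<Oplus>\<^bsub>U\<^esub>i\<in>F. f i) \<ominus>\<^bsub>U\<^esub> s)) (finite_subsets_at_top I)"
  proof (rule eventually_finite_subsets_at_top_weakI)
    fix F
    assume F: "finite F" "F \<subseteq> I"
    then have "f \<in> F \<rightarrow> carrier U"
      using f(1) by auto
    then have "(\<Oplus>\<^bsub>U\<^esub>i\<in>F. f i) \<in> carrier U"
        "(\<Oplus>\<^bsub>V\<^esub>i\<in>F. T (f i)) \<ominus>\<^bsub>V\<^esub> T s = T ((\<Oplus>\<^bsub>U\<^esub>i\<in>F. f i) \<ominus>\<^bsub>U\<^esub> s)"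
      using F T(1) f(2) by (simp_all add: hom_star_finsum hom_star_diff U.finsum_closed)
    then show "norm (pbar V p ((\<Oplus>\<^bsub>V\<^esub>i\<in>F. T (f i)) \<ominus>\<^bsub>V\<^esub> T s))
        \<le> C * pbar U p ((\<Oplus>\<^bsub>U\<^esub>i\<in>F. f i) \<ominus>\<^bsub>U\<^esub> s)"
      using C f(2) by (simp add: V.pbar_nonneg p)
  qed
  then show
    "((\<lambda>F. pbar V p ((\<Oplus>\<^bsub>V\<^esub>i\<in>F. T (f i)) \<ominus>\<^bsub>V\<^esub> T s)) \<longlongrightarrow> 0) (finite_subsets_at_top I)"
    using lim by (rule Lim_null_comparison)
qed

subsection \<open>Orthonormal bases and dual frames\<close>

text \<open>By orthonormality \<open>E\<^sub>j\<close> maps the error \<open>y\<^sub>F - y\<close> of a partial sum \<open>y\<^sub>F\<close> to \<open>0\<close> for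
  \<open>j \<in> F\<close> and to \<open>- E\<^sub>j y\<close> otherwise, so Parseval's identity for \<open>y\<^sub>F - y\<close> expresses its
  seminorm by the tail of the Parseval sum for \<open>y\<close>.\<close>

lemma g_orthonormal_basis_expansion:
  fixes V :: "'i \<Rightarrow> ('a::pro_cstar_algebra, 'v) hilbert_mod"
  assumes U: "hilbert_module U" and V: "\<And>i. i \<in> I \<Longrightarrow> hilbert_module (V i)"
    and basis: "g_orthonormal_basis I U V E" and y: "y \<in> carrier U"
  shows "has_sum_in U (\<lambda>i. adj U (V i) (E i) (E i y)) y I"
  unfolding has_sum_in_def
proof
  fix p :: "'a \<Rightarrow> real"
  assume p: "p \<in> Se"
  interpret U: hilbert_module U by (rule U)
  have pair: "hilbert_module_pair U (V i)" if "i \<in> I" for i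
    using U V[OF that] by (rule hilbert_module_pair.intro)
  have E: "E i \<in> hom_star U (V i)" if "i \<in> I" for i
    using basis that by (simp add: g_orthonormal_basis_def)
  have orth: "iprod U (adj U (V i) (E i) g) (adj U (V j) (E j) h) = (if i = j then iprod (V i) g h else 0)"
    if "i \<in> I" "j \<in> I" "g \<in> carrier (V i)" "h \<in> carrier (V j)" for i j g h
    using basis that by (simp add: g_orthonormal_basis_def)
  have parseval: "((\<lambda>i. (pbar (V i) p (E i x))\<^sup>2) has_sum (pbar U p x)\<^sup>2) I"
    if "x \<in> carrier U" for x
    using basis that p by (simp add: g_orthonormal_basis_def)
  have adjE: "adj U (V i) (E i) g \<in> carrier U" if "i \<in> I" "g \<in> carrier (V i)" for i g
    using hilbert_module_pair.adj_closed[OF pair E] that by blast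
  define q where "q i = (pbar (V i) p (E i y))\<^sup>2" for i
  define f where "f i = adj U (V i) (E i) (E i y)" for i
  have f: "f \<in> I \<rightarrow> carrier U"
    using adjE hom_star_closed[OF E y] by (auto simp: f_def)
  \<comment> \<open>Orthonormality says that \<open>E\<^sub>j E\<^sub>i\<^sup>*\<close> is the
    identity or 0; this is checked against every \<open>h\<close> in \<open>V j\<close> by moving
    \<open>E j\<close> across the inner product.\<close>
  have E_adj: "E j (adj U (V i) (E i) g) = (if i = j then g else \<zero>\<^bsub>V j\<^esub>)"
    if ij: "i \<in> I" "j \<in> I" and g: "g \<in> carrier (V i)" for i j g
  proof -
    interpret Vj: hilbert_module_pair U "V j"
      using ij(2) by (rule pair)
    show ?thesis
    proof (rule Vj.V.eq_if_iprod_eq)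
      show "E j (adj U (V i) (E i) g) \<in> carrier (V j)"
        using ij g by (intro hom_star_closed[OF E] adjE)
      show "(if i = j then g else \<zero>\<^bsub>V j\<^esub>) \<in> carrier (V j)"
        using g by auto
      fix h
      assume h: "h \<in> carrier (V j)"
      then have "iprod (V j) h (E j (adj U (V i) (E i) g))
          = (if j = i then iprod (V j) h g else 0)"
        using ij g by (simp add: Vj.iprod_adj' E adjE orth)
      moreover have "iprod (V j) h \<zero>\<^bsub>V j\<^esub> = 0"
        using Vj.V.star_iprod[of "\<zero>\<^bsub>V j\<^esub>" h] h by (simp add: Vj.V.iprod_zero_left)
      ultimately show "iprod (V j) h (E j (adj U (V i) (E i) g))
          = iprod (V j) h (if i = j then g else \<zero>\<^bsub>V j\<^esub>)"
        by auto
    qed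
  qed
  have E_diff: "pbar (V j) p (E j ((\<Oplus>\<^bsub>U\<^esub>i\<in>F. f i) \<ominus>\<^bsub>U\<^esub> y)) = (if j \<in> F then 0 else pbar (V j) p (E j y))"
    if F: "finite F" "F \<subseteq> I" and j: "j \<in> I" for F j
  proof -
    interpret Vj: hilbert_module_pair U "V j"
      using j by (rule pair)
    interpret cstar_seminormed p
      using p by (rule cstar_seminormed_Se)
    have fF: "f \<in> F \<rightarrow> carrier U"
      using f F by auto
    have Ey: "E j y \<in> carrier (V j)"
      using E[OF j] y by (rule hom_star_closed)
    have "(\<Oplus>\<^bsub>V j\<^esub>i\<in>F. E j (f i)) = (\<Oplus>\<^bsub>V j\<^esub>i\<in>F. if j = i then E j y else \<zero>\<^bsub>V j\<^esub>)"
    proof (rule Vj.V.finsum_cong')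
      show "(\<lambda>i. if j = i then E j y else \<zero>\<^bsub>V j\<^esub>) \<in> F \<rightarrow> carrier (V j)"
        using Ey by auto
      fix i
      assume "i \<in> F"
      then have "i \<in> I"
        using F by auto
      then show "E j (f i) = (if j = i then E j y else \<zero>\<^bsub>V j\<^esub>)"
        using j hom_star_closed[OF E y] by (simp add: f_def E_adj)
    qed simp
    also have "\<dots> = (if j \<in> F then E j y else \<zero>\<^bsub>V j\<^esub>)"
    proof (cases "j \<in> F")
      case True
      then show ?thesis
        using Vj.V.finsum_singleton[OF True F(1), of "\<lambda>_. E j y"] Ey by simp
    next
      case False
      then have "(\<Oplus>\<^bsub>V j\<^esub>i\<in>F. if j = i then E j y else \<zero>\<^bsub>V j\<^esub>) = (\<Oplus>\<^bsub>V j\<^esub>i\<in>F. \<zero>\<^bsub>V j\<^esub>)"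
        by (intro Vj.V.finsum_cong') auto
      then show ?thesis
        using False by simp
    qed
    finally have "E j ((\<Oplus>\<^bsub>U\<^esub>i\<in>F. f i) \<ominus>\<^bsub>U\<^esub> y)
        = (if j \<in> F then E j y else \<zero>\<^bsub>V j\<^esub>) \<ominus>\<^bsub>V j\<^esub> E j y"
      using F fF y E[OF j] by (simp add: Vj.hom_star_diff Vj.hom_star_finsum U.finsum_closed)
    moreover have "iprod (V j) (\<zero>\<^bsub>V j\<^esub> \<ominus>\<^bsub>V j\<^esub> E j y) (\<zero>\<^bsub>V j\<^esub> \<ominus>\<^bsub>V j\<^esub> E j y)
        = iprod (V j) (E j y) (E j y)"
      using Ey Vj.V.star_iprod[of "\<zero>\<^bsub>V j\<^esub>" "E j y"]
      by (simp add: Vj.V.iprod_diff_left Vj.V.iprod_diff_right Vj.V.iprod_zero_left)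
    ultimately show ?thesis
      using Ey by (simp add: pbar_def Vj.V.r_neg Vj.V.minus_eq Vj.V.iprod_zero_left)
  qed
  have "(q has_sum (pbar U p y)\<^sup>2) I"
    using parseval[OF y] by (simp add: q_def[abs_def])
  then have "((\<lambda>F. sqrt ((pbar U p y)\<^sup>2 - sum q F)) \<longlongrightarrow> sqrt ((pbar U p y)\<^sup>2 - (pbar U p y)\<^sup>2))
      (finite_subsets_at_top I)"
    unfolding has_sum_def by (intro tendsto_intros)
  moreover have "eventually (\<lambda>F. sqrt ((pbar U p y)\<^sup>2 - sum q F)
      = pbar U p ((\<Oplus>\<^bsub>U\<^esub>i\<in>F. f i) \<ominus>\<^bsub>U\<^esub> y)) (finite_subsets_at_top I)"
  proof (rule eventually_finite_subsets_at_top_weakI)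
    fix F
    assume F: "finite F" "F \<subseteq> I"
    define z where "z = (\<Oplus>\<^bsub>U\<^esub>i\<in>F. f i) \<ominus>\<^bsub>U\<^esub> y"
    have "z \<in> carrier U"
      using F f y unfolding z_def by (intro U.minus_closed U.finsum_closed) auto
    have "(q has_sum (pbar U p y)\<^sup>2 - sum q F) (I - F)"
      using \<open>(q has_sum (pbar U p y)\<^sup>2) I\<close> has_sum_finite[OF F(1)] F(2) by (rule has_sum_Diff)
    also have "?this \<longleftrightarrow> ((\<lambda>i. (pbar (V i) p (E i z))\<^sup>2) has_sum (pbar U p y)\<^sup>2 - sum q F) I"
      by (intro has_sum_cong_neutral) (auto simp: z_def E_diff[OF F] q_def)
    finally have "(pbar U p z)\<^sup>2 = (pbar U p y)\<^sup>2 - sum q F"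
      using parseval[OF \<open>z \<in> carrier U\<close>] has_sum_unique by blast
    then show "sqrt ((pbar U p y)\<^sup>2 - sum q F) = pbar U p z"
      using U.pbar_nonneg[OF p] by (metis real_sqrt_abs abs_of_nonneg)
  qed
  ultimately show "((\<lambda>F. pbar U p ((\<Oplus>\<^bsub>U\<^esub>i\<in>F. adj U (V i) (E i) (E i y)) \<ominus>\<^bsub>U\<^esub> y)) \<longlongrightarrow> 0)
      (finite_subsets_at_top I)"
    by (simp add: f_def filterlim_cong)
qed

section \<open>Dual frames in terms of g-operators\<close>

theorem theorem2p14:
  fixes I :: "'i set"
    and U :: "('a::pro_cstar_algebra, 'u) hilbert_mod"
    and V :: "'i \<Rightarrow> ('a, 'v) hilbert_mod"
    and K Q P :: "'u \<Rightarrow> 'u"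
    and E \<Gamma> T :: "'i \<Rightarrow> 'u \<Rightarrow> 'v"
  assumes "countable I" and "infinite I"
    and "hilbert_module U"
    and "\<And>i. i \<in> I \<Longrightarrow> hilbert_module (V i)"
    and "K \<in> hom_star U U"
    and "g_orthonormal_basis I U V E"
    and "K_g_frame I U V K \<Gamma>"
    and "is_g_operator I U V E \<Gamma> Q"
    and "g_frame I U V T"
    and "is_g_operator I U V E T P"
  shows "K_dual_g_frame I U V K \<Gamma> T \<longleftrightarrow> (\<forall>x\<in>carrier U. K x = Q (adj U U P x))"
proof -
  interpret U: hilbert_module U by fact
  interpret UU: hilbert_module_pair U U
    using assms(3) by (intro hilbert_module_pair.intro)
  have pair: "hilbert_module_pair U (V i)" if "i \<in> I" for i
    using assms(3) assms(4)[OF that] by (rule hilbert_module_pair.intro)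
  have E: "E i \<in> hom_star U (V i)" if "i \<in> I" for i
    using assms(6) that by (simp add: g_orthonormal_basis_def)
  have Q: "Q \<in> hom_star U U" "bounded_op U U Q"
      "\<And>i x. \<lbrakk>i \<in> I; x \<in> carrier U\<rbrakk> \<Longrightarrow> \<Gamma> i x = E i (adj U U Q x)"
    using assms(8) by (auto simp: is_g_operator_def)
  have P: "P \<in> hom_star U U" "\<And>i x. \<lbrakk>i \<in> I; x \<in> carrier U\<rbrakk> \<Longrightarrow> T i x = E i (adj U U P x)"
    using assms(10) by (auto simp: is_g_operator_def)
  have adj_\<Gamma>: "adj U (V i) (\<Gamma> i) g = Q (adj U (V i) (E i) g)"
    if i: "i \<in> I" and g: "g \<in> carrier (V i)" for i g
  proof -
    interpret Vi: hilbert_module_pair U "V i"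
      using i by (rule pair)
    note adjE = Vi.adj_closed[OF E[OF i] g]
    show ?thesis
    proof (rule Vi.adj_unique)
      show "Q (adj U (V i) (E i) g) \<in> carrier U"
        using Q(1) adjE by (rule hom_star_closed)
      fix x
      assume x: "x \<in> carrier U"
      show "iprod (V i) (\<Gamma> i x) g = iprod U x (Q (adj U (V i) (E i) g))"
        using UU.iprod_adj'[OF Q(1) x adjE] Vi.iprod_adj[OF E[OF i] g UU.adj_closed[OF Q(1) x]]
        by (simp add: Q(3)[OF i x])
    qed
  qed
  \<comment> \<open>The basis expansion of \<open>P\<^sup>* x\<close>, pushed through
    \<open>Q\<close>, shows that the sum exists; uniqueness of sums then decides every candidate
    \<open>s\<close>, in particular \<open>K x\<close>.\<close>
  have sum: "has_sum_in U (\<lambda>i. adj U (V i) (\<Gamma> i) (T i x)) s I \<longleftrightarrow> s = Q (adj U U P x)"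
    if x: "x \<in> carrier U" and s: "s \<in> carrier U" for x s
  proof -
    define w where "w = adj U U P x"
    have w: "w \<in> carrier U"
      unfolding w_def using P(1) x by (rule UU.adj_closed)
    have Ew: "adj U (V i) (E i) (E i w) \<in> carrier U" if "i \<in> I" for i
      using hilbert_module_pair.adj_closed[OF pair E] hom_star_closed[OF E w] that by blast
    have "has_sum_in U (\<lambda>i. Q (adj U (V i) (E i) (E i w))) (Q w) I"
      using Ew w by (intro has_sum_in_bounded_image[OF assms(3,3) Q(1,2)]
          g_orthonormal_basis_expansion assms) auto
    moreover have QEw: "(\<lambda>i. Q (adj U (V i) (E i) (E i w))) \<in> I \<rightarrow> carrier U"
      using Ew hom_star_closed[OF Q(1)] by auto
    ultimately have "has_sum_in U (\<lambda>i. Q (adj U (V i) (E i) (E i w))) s I \<longleftrightarrow> s = Q w"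
      using U.has_sum_in_unique[OF QEw s hom_star_closed[OF Q(1) w]] by auto
    moreover have "Q (adj U (V i) (E i) (E i w)) = adj U (V i) (\<Gamma> i) (T i x)" if "i \<in> I" for i
      using that hom_star_closed[OF E w] by (simp add: P(2) x adj_\<Gamma> flip: w_def)
    ultimately show ?thesis
      using has_sum_in_cong[OF assms(3) QEw, of "\<lambda>i. adj U (V i) (\<Gamma> i) (T i x)" s]
      by (simp add: w_def)
  qed
  show ?thesis
    using assms(7,9) sum hom_star_closed[OF assms(5)] by (simp add: K_dual_g_frame_def)
qed

end
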